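(* Let $\mathcal{H}$ be a complex infinite-dimensional Hilbert space, let $n>1$ be an integer, and let $A\in B(\mathcal{H})$ satisfy $A^*A^n=A^nA^*$ (equivalently, $A^n$ is normal). Then both $A$ and $A^*$ satisfy property $(\beta)_\epsilon$.
   Context: For an open set $\mathcal{U}\subseteq\mathbb{C}$, $\mathcal{E}(\mathcal{U},\mathcal{H})$ is the Fréchet space of infinitely differentiable $\mathcal{H}$-valued functions on $\mathcal{U}$ with the topology of uniform convergence of all derivatives on compact subsets of $\mathcal{U}$. An operator $S\in B(\mathcal{H})$ satisfies property $(\beta)_\epsilon$ at $\lambda\in\mathbb{C}$ if there is a neighborhood $\mathcal{N}$ of $\lambda$ such that for every open $\mathcal{U}\subseteq\mathcal{N}$ and every sequence $(f_k)$ in $\mathcal{E}(\mathcal{U},\mathcal{H})$, $(S-z)f_k(z)\to0$ in $\mathcal{E}(\mathcal{U},\mathcal{H})$ implies $f_k\to0$ in $\mathcal{E}(\mathcal{U},\mathcal{H})$; $S$ satisfies $(\beta)_\epsilon$ if it does so at every $\lambda\in\mathbb{C}$. *)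

theory Defs
  imports "HOL-Analysis.Analysis"
begin

class complex_vector = real_vector +
  fixes scaleC :: "complex \<Rightarrow> 'a \<Rightarrow> 'a" (infixr \<open>*\<^sub>C\<close> 75)
  assumes scaleC_add_right: "scaleC a (x + y) = scaleC a x + scaleC a y"
    and scaleC_add_left: "scaleC (a + b) x = scaleC a x + scaleC b x"
    and scaleC_scaleC: "scaleC a (scaleC b x) = scaleC (a * b) x"
    and scaleC_one: "scaleC 1 x = x"
    and scaleR_scaleC: "scaleR r x = scaleC (complex_of_real r) x"

class complex_inner = complex_vector + real_normed_vector +
  fixes cinner :: "'a \<Rightarrow> 'a \<Rightarrow> complex"
  assumes cinner_commute: "cinner x y = cnj (cinner y x)"
    and cinner_add_right: "cinner x (y + z) = cinner x y + cinner x z"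
    and cinner_scaleC_right: "cinner x (scaleC r y) = r * cinner x y"
    and cinner_ge_zero: "0 \<le> Re (cinner x x)"
    and cinner_eq_zero_iff: "cinner x x = 0 \<longleftrightarrow> x = 0"
    and norm_eq_sqrt_cinner: "norm x = sqrt (Re (cinner x x))"

class chilbert_space = complex_inner + complete_space

definition cspan :: "'a::complex_vector set \<Rightarrow> 'a set" where
  "cspan S = {(\<Sum>x\<in>T. c x *\<^sub>C x) | T c. finite T \<and> T \<subseteq> S}"

definition infinite_dimensional :: "'a::complex_vector itself \<Rightarrow> bool" where
  "infinite_dimensional _ \<longleftrightarrow> \<not> (\<exists>B::'a set. finite B \<and> cspan B = UNIV)"

definition bounded_clinear :: "('a::complex_inner \<Rightarrow> 'b::complex_inner) \<Rightarrow> bool" where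
  "bounded_clinear A \<longleftrightarrow>
     (\<forall>x y. A (x + y) = A x + A y) \<and> (\<forall>c x. A (c *\<^sub>C x) = c *\<^sub>C A x) \<and>
     (\<exists>K. \<forall>x. norm (A x) \<le> norm x * K)"

definition is_adjoint :: "('a::complex_inner \<Rightarrow> 'a) \<Rightarrow> ('a \<Rightarrow> 'a) \<Rightarrow> bool" where
  "is_adjoint A B \<longleftrightarrow> (\<forall>x y. cinner (A x) y = cinner x (B y))"

text \<open>Partial derivatives in the real directions x and y of a function C -> H
  (C identified with R^2).  False = d/dx, True = d/dy.\<close>
definition pderiv_dir :: "bool \<Rightarrow> (complex \<Rightarrow> 'a::real_normed_vector) \<Rightarrow> complex \<Rightarrow> 'a" where
  "pderiv_dir d f z =
     vector_derivative (\<lambda>t::real. f (z + (if d then \<i> else 1) * complex_of_real t)) (at 0)"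

text \<open>Iterated partial derivative; the list gives the directions, innermost first.\<close>
fun Dmulti :: "bool list \<Rightarrow> (complex \<Rightarrow> 'a::real_normed_vector) \<Rightarrow> complex \<Rightarrow> 'a" where
  "Dmulti [] f = f"
| "Dmulti (d # ds) f = Dmulti ds (pderiv_dir d f)"

definition smooth_on :: "complex set \<Rightarrow> (complex \<Rightarrow> 'a::real_normed_vector) \<Rightarrow> bool" where
  "smooth_on U f \<longleftrightarrow>
     (\<forall>ds. continuous_on U (Dmulti ds f) \<and>
        (\<forall>z\<in>U. \<forall>d. (\<lambda>t::real. Dmulti ds f (z + (if d then \<i> else 1) * complex_of_real t))
                       differentiable (at 0)))"

definition E_tendsto_zero :: "complex set \<Rightarrow> (nat \<Rightarrow> complex \<Rightarrow> 'a::real_normed_vector) \<Rightarrow> bool" where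
  "E_tendsto_zero U f \<longleftrightarrow>
     (\<forall>K ds. compact K \<and> K \<subseteq> U \<longrightarrow>
        uniform_limit K (\<lambda>k. Dmulti ds (f k)) (\<lambda>_. 0) sequentially)"

definition beta_eps_at :: "('a::chilbert_space \<Rightarrow> 'a) \<Rightarrow> complex \<Rightarrow> bool" where
  "beta_eps_at S w \<longleftrightarrow>
     (\<exists>N. open N \<and> w \<in> N \<and>
        (\<forall>U f. open U \<and> U \<subseteq> N \<and> (\<forall>k. smooth_on U (f k)) \<and>
               E_tendsto_zero U (\<lambda>k z. S (f k z) - z *\<^sub>C f k z)
               \<longrightarrow> E_tendsto_zero U f))"

definition beta_eps :: "('a::chilbert_space \<Rightarrow> 'a) \<Rightarrow> bool" where
  "beta_eps S \<longleftrightarrow> (\<forall>w. beta_eps_at S w)"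

end

theory Submission
  imports Defs
begin

text \<open>Let \<open>T = A\<^sup>n\<close>, which is normal. If \<open>(A - z) f\<^sub>k \<rightarrow> 0\<close>, then also
  \<open>h\<^sub>k = (T - z\<^sup>n) f\<^sub>k \<rightarrow> 0\<close>. Normality gives \<open>|(T - z\<^sup>n) x| = |(T* - cnj z\<^sup>n) x|\<close>, so with
  \<open>F\<^sub>j = dbar\<^sup>j f\<^sub>k\<close> the functions \<open>u\<^sub>j = (T* - cnj z\<^sup>n) F\<^sub>j\<close> tend to 0 locally uniformly, and
  \<open>n cnj z\<^bsup>n-1\<^esup> F\<^sub>j = u\<^bsub>j+1\<^esub> - dbar u\<^sub>j\<close>. Applying dbar repeatedly removes the factor
  \<open>cnj z\<^bsup>n-1\<^esup>\<close> and exhibits every \<open>F\<^sub>j\<close> as a sum of derivatives \<open>dbar\<^sup>i w\<close>, \<open>i \<le> n\<close>, of null sequences.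
  Since dbar is elliptic, such weak convergence of a sequence g together with
  \<open>dbar g \<rightarrow> 0\<close> forces \<open>g \<rightarrow> 0\<close>: the circle means of g around a point stay close to its value there,
  while averages of them against a weight vanishing at the boundary of the disc are small after
  integration by parts. This lowers the number of derivatives one at a time, without any
  appeal to the spectral theorem, and works at \<open>z = 0\<close> as well as elsewhere.\<close>

section \<open>Complex inner product spaces and adjoints\<close>

\<comment> \<open>Makes the integration of Banach-space valued functions available on
  \<open>chilbert_space\<close>.\<close>
subclass (in chilbert_space) banach ..

lemma cinner_add_left: "cinner (x + y) z = cinner x z + cinner y z"
  by (metis cinner_add_right cinner_commute complex_cnj_add)

lemma cinner_scaleC_left: "cinner (c *\<^sub>C x) y = cnj c * cinner x y"
  by (metis cinner_commute cinner_scaleC_right complex_cnj_mult)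

lemma power2_norm_eq_cinner: "(norm x)\<^sup>2 = Re (cinner x x)"
  by (simp add: norm_eq_sqrt_cinner cinner_ge_zero)

lemma norm_scaleC: "norm (c *\<^sub>C (x::'a::complex_inner)) = cmod c * norm x"
proof -
  have "cinner (c *\<^sub>C x) (c *\<^sub>C x) = complex_of_real ((cmod c)\<^sup>2) * cinner x x"
    using complex_norm_square[of c]
    by (simp add: cinner_scaleC_left cinner_scaleC_right mult_ac del: of_real_power)
  then have "(norm (c *\<^sub>C x))\<^sup>2 = (cmod c * norm x)\<^sup>2"
    by (simp add: power2_norm_eq_cinner power_mult_distrib)
  then show ?thesis by (simp add: power2_eq_iff_nonneg)
qed

lemma bounded_bilinear_scaleC:
  "bounded_bilinear (scaleC :: complex \<Rightarrow> 'a \<Rightarrow> 'a::complex_inner)"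
proof
  show "\<exists>K. \<forall>a b. norm (a *\<^sub>C (b::'a)) \<le> norm a * norm b * K"
    by (rule exI[of _ 1]) (simp add: norm_scaleC)
qed (auto simp: scaleC_add_left scaleC_add_right scaleR_scaleC scaleC_scaleC
    scaleR_conv_of_real mult_ac)

interpretation scaleC: bounded_bilinear "scaleC :: complex \<Rightarrow> 'a \<Rightarrow> 'a::complex_inner"
  by (rule bounded_bilinear_scaleC)

text \<open>Cauchy-Schwarz for the real part. The triangle inequality is part of the class, so it is
  enough to square it and expand both sides.\<close>

lemma Re_cinner_le: "Re (cinner x y) \<le> norm x * norm y"
proof -
  have "(norm (x + y))\<^sup>2 = (norm x)\<^sup>2 + 2 * Re (cinner x y) + (norm y)\<^sup>2"
    using cinner_commute[of y x]
    by (simp add: power2_norm_eq_cinner cinner_add_left cinner_add_right)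
  moreover have "(norm (x + y))\<^sup>2 \<le> (norm x + norm y)\<^sup>2"
    by (simp add: norm_triangle_ineq power_mono)
  ultimately show ?thesis by (simp add: power2_sum)
qed

lemma cinner_diff_right: "cinner x (y - z) = cinner x y - cinner x z"
  using cinner_add_right[of x "y - z" z] by simp

lemma cinner_diff_left: "cinner (x - y) z = cinner x z - cinner y z"
  using cinner_add_left[of "x - y" y z] by simp

lemma cinner_eqI:
  assumes "\<And>x. cinner x y = cinner x z"
  shows "y = z"
  using assms[of "y - z"] cinner_eq_zero_iff[of "y - z"] by (simp add: cinner_diff_right)

lemma bounded_clinear_bounded_linear:
  assumes "bounded_clinear A"
  shows "bounded_linear A"
  using assms unfolding bounded_clinear_def
  by (intro bounded_linear.intro linearI bounded_linear_axioms.intro) (auto simp: scaleR_scaleC)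

lemma bounded_clinear_scaleC: "bounded_clinear A \<Longrightarrow> A (c *\<^sub>C x) = c *\<^sub>C A x"
  unfolding bounded_clinear_def by blast

lemma bounded_clinearI:
  assumes "bounded_linear A" "\<And>c x. A (c *\<^sub>C x) = c *\<^sub>C A x"
  shows "bounded_clinear A"
  using bounded_linear.bounded[OF assms(1)] linear_add[OF bounded_linear.linear[OF assms(1)]] assms(2)
  unfolding bounded_clinear_def by blast

lemma bounded_clinear_funpow:
  fixes A :: "'a::complex_inner \<Rightarrow> 'a"
  assumes "bounded_clinear A"
  shows "bounded_clinear (A ^^ n)"
proof (induction n)
  case 0
  show ?case using bounded_clinearI[of "\<lambda>x::'a. x"] by (simp add: id_def bounded_linear_ident)
next
  case (Suc n)
  have "bounded_linear (\<lambda>x. A ((A ^^ n) x))"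
    by (rule bounded_linear_compose[OF assms[THEN bounded_clinear_bounded_linear]
        Suc[THEN bounded_clinear_bounded_linear]])
  then have "bounded_clinear (\<lambda>x. A ((A ^^ n) x))"
    by (rule bounded_clinearI) (simp only: bounded_clinear_scaleC[OF assms] bounded_clinear_scaleC[OF Suc])
  then show ?case by (simp add: o_def)
qed

lemma is_adjoint_commute: "is_adjoint A B \<Longrightarrow> is_adjoint B A"
  unfolding is_adjoint_def by (metis cinner_commute)

lemma is_adjoint_funpow:
  fixes A :: "'a::complex_inner \<Rightarrow> 'a"
  assumes "is_adjoint A B"
  shows "is_adjoint (A ^^ n) (B ^^ n)"
proof (induction n)
  case (Suc n)
  then show ?case using assms unfolding is_adjoint_def
    by (simp add: funpow_swap1)
qed (simp add: is_adjoint_def)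

text \<open>\<open>is_adjoint\<close> is a purely algebraic relation. Boundedness of
  \<open>B\<close> comes from writing the square of \<open>norm (B y)\<close> as
  \<open>Re (cinner (A (B y)) y)\<close>, applying Cauchy-Schwarz and cancelling one factor
  \<open>norm (B y)\<close>.\<close>

lemma bounded_clinear_adjoint:
  assumes A: "bounded_clinear A" and B: "is_adjoint A B"
  shows "bounded_clinear B"
proof -
  have adj: "cinner (A x) y = cinner x (B y)" for x y
    using B unfolding is_adjoint_def by blast
  obtain K where K: "norm (A x) \<le> norm x * K" for x
    using A unfolding bounded_clinear_def by blast
  have add: "B (x + y) = B x + B y" for x y
    by (rule cinner_eqI) (simp add: adj[symmetric] cinner_add_right)
  have scale: "B (c *\<^sub>C x) = c *\<^sub>C B x" for c x
    by (rule cinner_eqI) (simp add: adj[symmetric] cinner_scaleC_right)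
  \<comment> \<open>The definition of boundedness does not fix the sign of \<open>K\<close>, hence
    the absolute value.\<close>
  have bound: "norm (B y) \<le> norm y * \<bar>K\<bar>" for y
  proof (cases "B y = 0")
    case False
    have "norm (A (B y)) \<le> norm (B y) * \<bar>K\<bar>"
      using K[of "B y"] by (meson abs_ge_self mult_left_mono norm_ge_zero order_trans)
    then have "norm (A (B y)) * norm y \<le> norm (B y) * \<bar>K\<bar> * norm y"
      by (simp add: mult_right_mono)
    moreover have "(norm (B y))\<^sup>2 \<le> norm (A (B y)) * norm y"
      using Re_cinner_le[of "A (B y)" y] by (simp add: power2_norm_eq_cinner adj)
    ultimately have "norm (B y) * norm (B y) \<le> norm (B y) * (norm y * \<bar>K\<bar>)"
      by (simp add: power2_eq_square mult_ac)
    then show ?thesis using False by simp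
  qed simp
  show ?thesis unfolding bounded_clinear_def using add scale bound by blast
qed

text \<open>Both squared norms equal \<open>cinner x (S (S' x))\<close>.\<close>

lemma norm_adjoint_eq_if_commute:
  assumes "is_adjoint S S'" "\<And>x. S' (S x) = S (S' x)"
  shows "norm (S x) = norm (S' x)"
proof -
  have "cinner (S x) (S x) = cinner x (S (S' x))"
    using assms unfolding is_adjoint_def by simp
  also have "\<dots> = cinner (S' x) (S' x)"
    using is_adjoint_commute[OF assms(1)] unfolding is_adjoint_def by simp
  finally show ?thesis by (simp add: norm_eq_sqrt_cinner)
qed

text \<open>Subtracting a scalar from a normal operator leaves it normal, with adjoint
  \<open>S' - cnj c\<close>. Normality enters the estimates below only through this identity of
  norms.\<close>

lemma norm_diff_scaleC_normal:
  assumes S: "bounded_clinear S" and adj: "is_adjoint S S'"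
    and comm: "\<And>x. S' (S x) = S (S' x)"
  shows "norm (S x - c *\<^sub>C x) = norm (S' x - cnj c *\<^sub>C x)"
proof (rule norm_adjoint_eq_if_commute[where S="\<lambda>x. S x - c *\<^sub>C x" and S'="\<lambda>x. S' x - cnj c *\<^sub>C x"])
  have S': "bounded_clinear S'" by (rule bounded_clinear_adjoint[OF S adj])
  show "is_adjoint (\<lambda>x. S x - c *\<^sub>C x) (\<lambda>x. S' x - cnj c *\<^sub>C x)"
    using adj unfolding is_adjoint_def
    by (simp add: cinner_diff_left cinner_diff_right cinner_scaleC_left cinner_scaleC_right)
  show "S' (S x - c *\<^sub>C x) - cnj c *\<^sub>C (S x - c *\<^sub>C x) =
        S (S' x - cnj c *\<^sub>C x) - c *\<^sub>C (S' x - cnj c *\<^sub>C x)" for x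
    by (simp add: linear_diff[OF bounded_linear.linear, OF bounded_clinear_bounded_linear] S S' bounded_clinear_scaleC[OF S] bounded_clinear_scaleC[OF S'] comm
        scaleC.diff_right scaleC_scaleC mult.commute)
qed

section \<open>Partial derivatives and smooth functions\<close>

text \<open>\<open>pderiv_dir\<close> has a value even where no derivative exists. This relation
  also asserts existence, so it can be pushed through sums and products.\<close>

definition has_pd :: "bool \<Rightarrow> (complex \<Rightarrow> 'a::real_normed_vector) \<Rightarrow> 'a \<Rightarrow> complex \<Rightarrow> bool" where
  "has_pd d f D z \<longleftrightarrow>
     ((\<lambda>t::real. f (z + (if d then \<i> else 1) * complex_of_real t)) has_vector_derivative D) (at 0)"

lemma has_pd_imp_pderiv_dir: "has_pd d f D z \<Longrightarrow> pderiv_dir d f z = D"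
  unfolding has_pd_def pderiv_dir_def by (rule vector_derivative_at)

lemma has_pd_cong:
  assumes "open U" "z \<in> U" "\<And>w. w \<in> U \<Longrightarrow> f w = g w"
  shows "has_pd d f D z \<longleftrightarrow> has_pd d g D z"
proof -
  let ?\<gamma> = "\<lambda>t::real. z + (if d then \<i> else 1) * complex_of_real t"
  have "open (?\<gamma> -` U)"
    by (rule open_vimage[OF assms(1)]) (intro continuous_intros)
  moreover have "0 \<in> ?\<gamma> -` U" using assms(2) by simp
  ultimately show ?thesis unfolding has_pd_def using assms(3)
    by (intro iffI; elim has_vector_derivative_transform_within_open) auto
qed

lemma pderiv_dir_cong:
  assumes "open U" "z \<in> U" "\<And>w. w \<in> U \<Longrightarrow> f w = g w"
  shows "pderiv_dir d f z = pderiv_dir d g z"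
proof -
  \<comment> \<open>Both values are chosen from one and the same predicate, which only looks at the
    function near \<open>z\<close>; this works whether or not a derivative exists.\<close>
  have "pderiv_dir d f z = (SOME D. has_pd d f D z)" for f :: "complex \<Rightarrow> 'a"
    by (simp only: pderiv_dir_def vector_derivative_def has_pd_def)
  then show ?thesis by (simp add: has_pd_cong[OF assms])
qed

lemma Dmulti_cong:
  assumes "open U" "z \<in> U" "\<And>w. w \<in> U \<Longrightarrow> f w = g w"
  shows "Dmulti ds f z = Dmulti ds g z"
  using assms
proof (induction ds arbitrary: f g z)
  case (Cons d ds)
  then show ?case using pderiv_dir_cong[OF Cons.prems(1)] by (metis Dmulti.simps(2))
qed simp

lemma smooth_on_imp_continuous_on: "smooth_on U f \<Longrightarrow> continuous_on U f"
  unfolding smooth_on_def by (metis Dmulti.simps(1))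

lemma smooth_on_pderiv_dir: "smooth_on U f \<Longrightarrow> smooth_on U (pderiv_dir d f)"
  unfolding smooth_on_def by (metis Dmulti.simps(2))

lemma smooth_on_has_pd: "smooth_on U f \<Longrightarrow> z \<in> U \<Longrightarrow> has_pd d f (pderiv_dir d f z) z"
  unfolding smooth_on_def has_pd_def pderiv_dir_def vector_derivative_works[symmetric]
  by (drule spec[of _ "[]"]) simp

text \<open>Coinduction for smoothness: a class of continuous functions closed under partial
  differentiation consists of smooth functions. It replaces explicit formulas for iterated
  derivatives of sums and products.\<close>

lemma smooth_on_coinduct:
  assumes U: "open U" and f: "P f"
    and cont: "\<And>f. P f \<Longrightarrow> continuous_on U f"
    and step: "\<And>f d. P f \<Longrightarrow> \<exists>g. P g \<and> (\<forall>z\<in>U. has_pd d f (g z) z)"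
  shows "smooth_on U f"
proof -
  have "continuous_on U (Dmulti ds f) \<and> (\<forall>z\<in>U. \<forall>d. \<exists>D. has_pd d (Dmulti ds f) D z)" for ds
    using f
  proof (induction ds arbitrary: f)
    case Nil
    then show ?case using cont step by fastforce
  next
    case (Cons d ds)
    obtain g where g: "P g" "\<And>z. z \<in> U \<Longrightarrow> has_pd d f (g z) z"
      using step[OF Cons.prems] by blast
    have eq: "Dmulti (d # ds) f z = Dmulti ds g z" if "z \<in> U" for z
      by (simp, rule Dmulti_cong[OF U that]) (simp add: has_pd_imp_pderiv_dir[OF g(2)])
    have "continuous_on U (Dmulti (d # ds) f)"
      using Cons.IH[OF g(1)] eq by (subst continuous_on_cong[OF refl eq]) auto
    moreover have "\<exists>D. has_pd d' (Dmulti (d # ds) f) D z" if "z \<in> U" for z d'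
      using Cons.IH[OF g(1)] that by (subst has_pd_cong[OF U that eq]) auto
    ultimately show ?case by blast
  qed
  then show ?thesis
    unfolding smooth_on_def has_pd_def by (metis differentiableI_vector)
qed

lemma smooth_on_cong:
  assumes "open U" "\<And>w. w \<in> U \<Longrightarrow> f w = g w"
  shows "smooth_on U f \<longleftrightarrow> smooth_on U g"
proof -
  have "smooth_on U g" if "smooth_on U f" "\<And>w. w \<in> U \<Longrightarrow> f w = g w" for f g :: "complex \<Rightarrow> 'a"
  proof (rule smooth_on_coinduct[OF assms(1), where P="\<lambda>g. \<exists>f. smooth_on U f \<and> (\<forall>w\<in>U. f w = g w)"])
    fix g :: "complex \<Rightarrow> 'a" assume "\<exists>f. smooth_on U f \<and> (\<forall>w\<in>U. f w = g w)"
    then obtain f where f: "smooth_on U f" "\<And>w. w \<in> U \<Longrightarrow> f w = g w" by blast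
    show "continuous_on U g"
      by (rule continuous_on_eq[OF smooth_on_imp_continuous_on[OF f(1)] f(2)])
    show "\<exists>h. (\<exists>f. smooth_on U f \<and> (\<forall>w\<in>U. f w = h w)) \<and> (\<forall>z\<in>U. has_pd d g (h z) z)" for d
      using smooth_on_has_pd[OF f(1)] has_pd_cong[OF assms(1) _ f(2)] smooth_on_pderiv_dir[OF f(1)]
      by (intro exI[of _ "pderiv_dir d f"] conjI) auto
  qed (use that in blast)
  then show ?thesis using assms(2) by metis
qed

section \<open>Differentiation rules and closure properties of smooth functions\<close>

lemma has_pd_add: "has_pd d f D z \<Longrightarrow> has_pd d g E z \<Longrightarrow> has_pd d (\<lambda>z. f z + g z) (D + E) z"
  unfolding has_pd_def by (rule has_vector_derivative_add)

lemma has_pd_bounded_linear: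
  "bounded_linear L \<Longrightarrow> has_pd d f D z \<Longrightarrow> has_pd d (\<lambda>z. L (f z)) (L D) z"
  unfolding has_pd_def by (rule bounded_linear.has_vector_derivative)

lemma has_pd_scaleC:
  fixes f :: "complex \<Rightarrow> 'a::complex_inner"
  assumes "has_pd d c E z" "has_pd d f D z"
  shows "has_pd d (\<lambda>z. c z *\<^sub>C f z) (c z *\<^sub>C D + E *\<^sub>C f z) z"
  using bounded_bilinear.has_vector_derivative[OF bounded_bilinear_scaleC
      assms[unfolded has_pd_def]]
  unfolding has_pd_def by simp

lemma has_pd_linear:
  assumes "bounded_linear \<phi>"
  shows "has_pd d \<phi> (\<phi> (if d then \<i> else 1)) z"
proof -
  have "has_pd d (\<lambda>z. z) (if d then \<i> else 1) z"
    unfolding has_pd_def by (auto intro!: derivative_eq_intros)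
  from has_pd_bounded_linear[OF assms this] show ?thesis .
qed

lemma smooth_on_bounded_linear:
  assumes "open U" "bounded_linear L" "smooth_on U f"
  shows "smooth_on U (\<lambda>z. L (f z))"
proof (rule smooth_on_coinduct[OF assms(1), where P="\<lambda>g. \<exists>f. smooth_on U f \<and> g = (\<lambda>z. L (f z))"])
  fix g assume "\<exists>f. smooth_on U f \<and> g = (\<lambda>z. L (f z))"
  then obtain f where f: "smooth_on U f" "g = (\<lambda>z. L (f z))" by blast
  show "continuous_on U g"
    unfolding f(2) by (intro bounded_linear.continuous_on[OF assms(2)] smooth_on_imp_continuous_on f(1))
  show "\<exists>h. (\<exists>f. smooth_on U f \<and> h = (\<lambda>z. L (f z))) \<and> (\<forall>z\<in>U. has_pd d g (h z) z)" for d
    unfolding f(2) using smooth_on_pderiv_dir[OF f(1)] smooth_on_has_pd[OF f(1)]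
    by (intro exI[of _ "\<lambda>z. L (pderiv_dir d f z)"] conjI) (auto intro: has_pd_bounded_linear[OF assms(2)])
qed (use assms in blast)

lemma smooth_on_add:
  assumes "open U" "smooth_on U f" "smooth_on U g"
  shows "smooth_on U (\<lambda>z. f z + g z)"
proof (rule smooth_on_coinduct[OF assms(1),
    where P="\<lambda>h. \<exists>f g. smooth_on U f \<and> smooth_on U g \<and> h = (\<lambda>z. f z + g z)"])
  fix h :: "complex \<Rightarrow> 'a" assume "\<exists>f g. smooth_on U f \<and> smooth_on U g \<and> h = (\<lambda>z. f z + g z)"
  then obtain f g where fg: "smooth_on U f" "smooth_on U g" "h = (\<lambda>z. f z + g z)" by blast
  show "continuous_on U h"
    unfolding fg(3) by (intro continuous_on_add smooth_on_imp_continuous_on fg)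
  show "\<exists>k. (\<exists>f g. smooth_on U f \<and> smooth_on U g \<and> k = (\<lambda>z. f z + g z)) \<and> (\<forall>z\<in>U. has_pd d h (k z) z)" for d
    unfolding fg(3)
    using smooth_on_pderiv_dir[OF fg(1)] smooth_on_pderiv_dir[OF fg(2)]
      smooth_on_has_pd[OF fg(1)] smooth_on_has_pd[OF fg(2)]
    by (intro exI[of _ "\<lambda>z. pderiv_dir d f z + pderiv_dir d g z"] conjI
        exI[of _ "pderiv_dir d f"] exI[of _ "pderiv_dir d g"] refl) (auto intro: has_pd_add)
qed (use assms in blast)

text \<open>The invariant is \<open>\<phi> f + g\<close> instead of \<open>\<phi> f\<close>:
  differentiation also produces a constant multiple of \<open>f\<close>, which has lost its factor
  \<open>\<phi>\<close> and is absorbed by \<open>g\<close>. Real linearity of \<open>\<phi>\<close>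
  covers both the identity and \<open>cnj\<close>.\<close>

lemma smooth_on_scaleC_linear:
  fixes f :: "complex \<Rightarrow> 'a::complex_inner"
  assumes U: "open U" and \<phi>: "bounded_linear \<phi>" and f: "smooth_on U f"
  shows "smooth_on U (\<lambda>z. \<phi> z *\<^sub>C f z)"
proof (rule smooth_on_coinduct[OF U,
    where P="\<lambda>h. \<exists>f g. smooth_on U f \<and> smooth_on U g \<and> h = (\<lambda>z. \<phi> z *\<^sub>C f z + g z)"])
  have "smooth_on U (\<lambda>z. 0::'a)"
    using smooth_on_bounded_linear[OF U bounded_linear_zero f] .
  then show "\<exists>f' g. smooth_on U f' \<and> smooth_on U g \<and> (\<lambda>z. \<phi> z *\<^sub>C f z) = (\<lambda>z. \<phi> z *\<^sub>C f' z + g z)"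
    using f by (intro exI[of _ f] exI[of _ "\<lambda>z. 0"]) auto
  fix h :: "complex \<Rightarrow> 'a" assume "\<exists>f g. smooth_on U f \<and> smooth_on U g \<and> h = (\<lambda>z. \<phi> z *\<^sub>C f z + g z)"
  then obtain f g where fg: "smooth_on U f" "smooth_on U g" and h: "h = (\<lambda>z. \<phi> z *\<^sub>C f z + g z)"
    by blast
  show "continuous_on U h"
    unfolding h by (intro continuous_on_add smooth_on_imp_continuous_on fg
        scaleC.continuous_on bounded_linear.continuous_on[OF \<phi>] continuous_on_id)
  fix d
  let ?k = "\<lambda>z. \<phi> z *\<^sub>C pderiv_dir d f z + (\<phi> (if d then \<i> else 1) *\<^sub>C f z + pderiv_dir d g z)"
  have "smooth_on U (\<lambda>z. \<phi> (if d then \<i> else 1) *\<^sub>C f z + pderiv_dir d g z)"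
    by (intro smooth_on_add U smooth_on_pderiv_dir fg
        smooth_on_bounded_linear[OF U scaleC.bounded_linear_right])
  moreover have "has_pd d h (?k z) z" if "z \<in> U" for z
    unfolding h
    using has_pd_add[OF has_pd_scaleC[OF has_pd_linear[OF \<phi>] smooth_on_has_pd[OF fg(1) that]]
        smooth_on_has_pd[OF fg(2) that]] by (simp add: add.assoc)
  ultimately show "\<exists>k. (\<exists>f g. smooth_on U f \<and> smooth_on U g \<and> k = (\<lambda>z. \<phi> z *\<^sub>C f z + g z)) \<and>
      (\<forall>z\<in>U. has_pd d h (k z) z)"
    using smooth_on_pderiv_dir[OF fg(1)]
    by (intro exI[of _ ?k] conjI ballI exI[of _ "pderiv_dir d f"]
        exI[of _ "\<lambda>z. \<phi> (if d then \<i> else 1) *\<^sub>C f z + pderiv_dir d g z"]) auto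
qed

lemma smooth_on_scaleC_power:
  fixes f :: "complex \<Rightarrow> 'a::complex_inner"
  assumes U: "open U" and \<phi>: "bounded_linear \<phi>" and f: "smooth_on U f"
  shows "smooth_on U (\<lambda>z. \<phi> z ^ n *\<^sub>C f z)"
proof (induction n)
  case (Suc n)
  from smooth_on_scaleC_linear[OF U \<phi> this] show ?case by (simp add: scaleC_scaleC)
qed (simp add: scaleC_one f)

lemma has_pd_scaleC_power:
  fixes f :: "complex \<Rightarrow> 'a::complex_inner"
  assumes "bounded_linear \<phi>" "has_pd d f D z"
  shows "has_pd d (\<lambda>z. \<phi> z ^ n *\<^sub>C f z)
    (\<phi> z ^ n *\<^sub>C D + (of_nat n * \<phi> z ^ (n - 1) * \<phi> (if d then \<i> else 1)) *\<^sub>C f z) z"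
proof -
  have "has_pd d (\<lambda>z. \<phi> z ^ n) (of_nat n * \<phi> z ^ (n - 1) * \<phi> (if d then \<i> else 1)) z"
  proof (induction n)
    case (Suc n)
    have "has_pd d (\<lambda>z. \<phi> z * \<phi> z ^ n) (\<phi> z * (of_nat n * \<phi> z ^ (n - 1) * \<phi> (if d then \<i> else 1))
       + \<phi> (if d then \<i> else 1) * \<phi> z ^ n) z"
      using has_vector_derivative_mult[OF has_pd_linear[OF assms(1), unfolded has_pd_def] Suc[unfolded has_pd_def]]
      unfolding has_pd_def by simp
    \<comment> \<open>For \<open>n = 0\<close> the truncated exponent \<open>n - 1\<close> is
      harmless because its coefficient is 0; otherwise \<open>\<phi> z * \<phi> z ^ (n - 1)\<close>
      is \<open>\<phi> z ^ n\<close>.\<close>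
    then show ?case by (cases n) (simp_all add: algebra_simps)
  qed (simp add: has_pd_def)
  from has_pd_scaleC[OF this assms(2)] show ?thesis .
qed

text \<open>Continuous partial derivatives give a total derivative. Polar coordinates need it for
  the chain rule, since \<open>smooth_on\<close> speaks of the two coordinate directions
  only.\<close>

lemma smooth_on_has_derivative:
  fixes f :: "complex \<Rightarrow> 'a::real_normed_vector"
  assumes U: "open U" and f: "smooth_on U f" and z: "z \<in> U"
  shows "(f has_derivative (\<lambda>h. Re h *\<^sub>R pderiv_dir False f z + Im h *\<^sub>R pderiv_dir True f z)) (at z)"
proof -
  obtain e where e: "e > 0" "ball z e \<subseteq> U" using U z openE by blast
  \<comment> \<open>Half-sides \<open>e/2\<close> keep the open square inside the ball, because the
    modulus is at most the sum of the two coordinate distances.\<close>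
  define X where "X = {Re z - e/2 <..< Re z + e/2}"
  define Y where "Y = {Im z - e/2 <..< Im z + e/2}"
  have XY: "Complex x y \<in> U" if "x \<in> X" "y \<in> Y" for x y
  proof -
    have "cmod (Complex x y - z) \<le> \<bar>x - Re z\<bar> + \<bar>y - Im z\<bar>"
      using cmod_le[of "Complex x y - z"] by simp
    also have "\<dots> < e" using that unfolding X_def Y_def by (auto simp: abs_if field_simps)
    finally show ?thesis using e(2) by (auto simp: dist_norm norm_minus_commute)
  qed
  have zXY: "Re z \<in> X" "Im z \<in> Y" using e(1) by (auto simp: X_def Y_def)
  have dx: "((\<lambda>x. f (Complex x y)) has_vector_derivative pderiv_dir False f (Complex x y)) (at x)"
    if "x \<in> X" "y \<in> Y" for x y
  proof -
    have "((\<lambda>t. t - x) has_vector_derivative 1) (at x)"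
      by (auto intro!: derivative_eq_intros)
    from vector_diff_chain_at[OF this, of "\<lambda>t. f (Complex x y + complex_of_real t)"
        "pderiv_dir False f (Complex x y)"]
    have "((\<lambda>t. f (Complex x y + complex_of_real t)) \<circ> (\<lambda>t. t - x) has_vector_derivative
        pderiv_dir False f (Complex x y)) (at x)"
      using smooth_on_has_pd[OF f XY[OF that], of False] by (simp add: has_pd_def)
    moreover have "(\<lambda>t. f (Complex x y + complex_of_real t)) \<circ> (\<lambda>t. t - x) = (\<lambda>x. f (Complex x y))"
      by (auto simp: fun_eq_iff complex_eq_iff intro!: arg_cong[where f=f])
    ultimately show ?thesis by simp
  qed
  have dy: "((\<lambda>y. f (Complex x y)) has_vector_derivative pderiv_dir True f (Complex x y)) (at y)"
    if "x \<in> X" "y \<in> Y" for x y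
  proof -
    have "((\<lambda>t. t - y) has_vector_derivative 1) (at y)"
      by (auto intro!: derivative_eq_intros)
    from vector_diff_chain_at[OF this, of "\<lambda>t. f (Complex x y + \<i> * complex_of_real t)"
        "pderiv_dir True f (Complex x y)"]
    have "((\<lambda>t. f (Complex x y + \<i> * complex_of_real t)) \<circ> (\<lambda>t. t - y) has_vector_derivative
        pderiv_dir True f (Complex x y)) (at y)"
      using smooth_on_has_pd[OF f XY[OF that], of True] by (simp add: has_pd_def)
    moreover have "(\<lambda>t. f (Complex x y + \<i> * complex_of_real t)) \<circ> (\<lambda>t. t - y) = (\<lambda>y. f (Complex x y))"
      by (auto simp: fun_eq_iff complex_eq_iff intro!: arg_cong[where f=f])
    ultimately show ?thesis by simp
  qed
  have open_XY: "open (X \<times> Y)" by (simp add: X_def Y_def open_Times)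
  \<comment> \<open>The rule for partial derivatives asks for continuity of the second one as a map
    into bounded operators.\<close>
  have cont: "continuous (at (Re z, Im z) within X \<times> Y)
    (\<lambda>(x, y). blinfun_scaleR_left (pderiv_dir True f (Complex x y)))"
  proof -
    have "continuous_on (X \<times> Y) (\<lambda>p. pderiv_dir True f (Complex (fst p) (snd p)))"
      by (rule continuous_on_compose2[OF smooth_on_imp_continuous_on[OF smooth_on_pderiv_dir[OF f]]])
        (auto simp: Complex_eq intro!: continuous_intros XY[unfolded Complex_eq])
    then have "continuous (at (Re z, Im z) within X \<times> Y) (\<lambda>p. pderiv_dir True f (Complex (fst p) (snd p)))"
      using zXY by (simp add: continuous_on_eq_continuous_within)
    then show ?thesis
      unfolding split_beta
      by (rule bounded_linear.continuous[OF bounded_linear_blinfun_scaleR_left])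
  qed
  have "((\<lambda>(x, y). f (Complex x y)) has_derivative
     (\<lambda>(tx, ty). tx *\<^sub>R pderiv_dir False f (Complex (Re z) (Im z)) +
        blinfun_scaleR_left (pderiv_dir True f (Complex (Re z) (Im z))) ty)) (at (Re z, Im z) within X \<times> Y)"
  proof (rule has_derivative_partialsI)
    show "((\<lambda>x. f (Complex x (Im z))) has_derivative (\<lambda>tx. tx *\<^sub>R pderiv_dir False f (Complex (Re z) (Im z))))
        (at (Re z) within X)"
      using dx[OF zXY] by (simp add: has_vector_derivative_def has_derivative_at_withinI)
    show "((\<lambda>y. f (Complex x y)) has_derivative blinfun_apply (blinfun_scaleR_left (pderiv_dir True f (Complex x y))))
        (at y within Y)" if "x \<in> X" "y \<in> Y" for x y
      using dy[OF that] by (simp add: has_vector_derivative_def has_derivative_at_withinI)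
    show "convex Y" by (simp add: Y_def)
  qed (use cont zXY in auto)
  then have *: "((\<lambda>(x, y). f (Complex x y)) has_derivative
     (\<lambda>(tx, ty). tx *\<^sub>R pderiv_dir False f z + ty *\<^sub>R pderiv_dir True f z)) (at (Re z, Im z))"
    using open_XY zXY by (simp add: at_within_open[of _ "X \<times> Y"])
  have "((\<lambda>w. (Re w, Im w)) has_derivative (\<lambda>w. (Re w, Im w))) (at z)"
    by (intro derivative_intros)
  from diff_chain_at[OF this *] show ?thesis
    by (simp add: o_def)
qed

section \<open>The Cauchy-Riemann operator and its product rules\<close>

definition dbar :: "(complex \<Rightarrow> 'a::complex_inner) \<Rightarrow> complex \<Rightarrow> 'a" where
  "dbar f z = (1/2) *\<^sub>C (pderiv_dir False f z + \<i> *\<^sub>C pderiv_dir True f z)"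

lemma dbar_cong:
  assumes "open U" "z \<in> U" "\<And>w. w \<in> U \<Longrightarrow> f w = g w"
  shows "dbar f z = dbar g z"
  by (simp only: dbar_def pderiv_dir_cong[OF assms])

lemma smooth_on_scaleC_const:
  fixes f :: "complex \<Rightarrow> 'a::complex_inner"
  shows "open U \<Longrightarrow> smooth_on U f \<Longrightarrow> smooth_on U (\<lambda>z. c *\<^sub>C f z)"
  by (rule smooth_on_bounded_linear[OF _ scaleC.bounded_linear_right])

lemma smooth_on_dbar: "open U \<Longrightarrow> smooth_on U f \<Longrightarrow> smooth_on U (dbar f)"
  unfolding dbar_def[abs_def]
  by (intro smooth_on_scaleC_const smooth_on_add smooth_on_pderiv_dir)

lemma has_pd_imp_dbar:
  "has_pd False f D z \<Longrightarrow> has_pd True f E z \<Longrightarrow> dbar f z = (1/2) *\<^sub>C (D + \<i> *\<^sub>C E)"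
  by (simp add: dbar_def has_pd_imp_pderiv_dir)

lemma dbar_add:
  assumes "smooth_on U f" "smooth_on U g" "z \<in> U"
  shows "dbar (\<lambda>z. f z + g z) z = dbar f z + dbar g z"
  using has_pd_imp_dbar[OF has_pd_add[OF smooth_on_has_pd[OF assms(1,3)] smooth_on_has_pd[OF assms(2,3)]]
      has_pd_add[OF smooth_on_has_pd[OF assms(1,3)] smooth_on_has_pd[OF assms(2,3)]]]
  by (simp add: dbar_def scaleC_add_right algebra_simps)

lemma dbar_bounded_clinear:
  assumes L: "bounded_clinear L" and f: "smooth_on U f" "z \<in> U"
  shows "dbar (\<lambda>z. L (f z)) z = L (dbar f z)"
  using has_pd_imp_dbar[OF has_pd_bounded_linear[OF bounded_clinear_bounded_linear[OF L] smooth_on_has_pd[OF f]]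
      has_pd_bounded_linear[OF bounded_clinear_bounded_linear[OF L] smooth_on_has_pd[OF f]]]
  by (simp add: dbar_def bounded_clinear_scaleC[OF L]
      linear_add[OF bounded_linear.linear[OF bounded_clinear_bounded_linear[OF L]]])

lemma bounded_clinear_scaleC_const: "bounded_clinear (\<lambda>x. c *\<^sub>C (x::'a::complex_inner))"
  by (rule bounded_clinearI[OF scaleC.bounded_linear_right]) (simp add: scaleC_scaleC mult.commute)

lemma dbar_scaleC_const:
  assumes "smooth_on U f" "z \<in> U"
  shows "dbar (\<lambda>z. c *\<^sub>C f z) z = c *\<^sub>C dbar f z"
  by (rule dbar_bounded_clinear[OF bounded_clinear_scaleC_const assms])

text \<open>The number \<open>(\<phi> 1 + \<i> * \<phi> \<i>) / 2\<close> is dbar of the real-linear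
  map \<open>\<phi>\<close>: 0 for the identity, 1 for \<open>cnj\<close>.\<close>

lemma dbar_scaleC_power:
  fixes f :: "complex \<Rightarrow> 'a::complex_inner"
  assumes \<phi>: "bounded_linear \<phi>" and f: "smooth_on U f" "z \<in> U"
  shows "dbar (\<lambda>z. \<phi> z ^ n *\<^sub>C f z) z = \<phi> z ^ n *\<^sub>C dbar f z +
    (of_nat n * \<phi> z ^ (n - 1) * ((\<phi> 1 + \<i> * \<phi> \<i>) / 2)) *\<^sub>C f z"
proof -
  note pd = has_pd_scaleC_power[OF \<phi> smooth_on_has_pd[OF f]]
  have "dbar (\<lambda>z. \<phi> z ^ n *\<^sub>C f z) z =
     (1/2) *\<^sub>C ((\<phi> z ^ n *\<^sub>C pderiv_dir False f z + (of_nat n * \<phi> z ^ (n - 1) * \<phi> 1) *\<^sub>C f z) +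
      \<i> *\<^sub>C (\<phi> z ^ n *\<^sub>C pderiv_dir True f z + (of_nat n * \<phi> z ^ (n - 1) * \<phi> \<i>) *\<^sub>C f z))"
    using has_pd_imp_dbar[OF pd pd] by simp
  also have "\<dots> = \<phi> z ^ n *\<^sub>C dbar f z +
    ((1/2 * (of_nat n * \<phi> z ^ (n - 1) * \<phi> 1)) *\<^sub>C f z + (1/2 * (\<i> * (of_nat n * \<phi> z ^ (n - 1) * \<phi> \<i>))) *\<^sub>C f z)"
    by (simp add: dbar_def scaleC_add_right scaleC_scaleC mult_ac)
  also have "\<dots> = \<phi> z ^ n *\<^sub>C dbar f z +
    (of_nat n * \<phi> z ^ (n - 1) * ((\<phi> 1 + \<i> * \<phi> \<i>) / 2)) *\<^sub>C f z"
    unfolding scaleC_add_left[symmetric] by (simp add: field_simps)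
  finally show ?thesis .
qed

lemma dbar_power:
  fixes f :: "complex \<Rightarrow> 'a::complex_inner"
  assumes "smooth_on U f" "z \<in> U"
  shows "dbar (\<lambda>z. z ^ n *\<^sub>C f z) z = z ^ n *\<^sub>C dbar f z"
  using dbar_scaleC_power[OF bounded_linear_ident assms] by (simp add: scaleC.zero_left)

lemma dbar_cnj_power:
  fixes f :: "complex \<Rightarrow> 'a::complex_inner"
  assumes "smooth_on U f" "z \<in> U"
  shows "dbar (\<lambda>z. cnj z ^ n *\<^sub>C f z) z = cnj z ^ n *\<^sub>C dbar f z + (of_nat n * cnj z ^ (n - 1)) *\<^sub>C f z"
  using dbar_scaleC_power[OF bounded_linear_cnj assms] by simp

text \<open>\<open>z - z0\<close> is affine, not linear, so each new factor is split as
  \<open>z\<close> times the previous function minus \<open>z0\<close> times it. Smoothness and the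
  formula are proved together because the rules for dbar take smooth arguments.\<close>

lemma smooth_on_dbar_power_centred:
  fixes f :: "complex \<Rightarrow> 'a::complex_inner"
  assumes U: "open U" and f: "smooth_on U f"
  shows "smooth_on U (\<lambda>z. (z - z0) ^ n *\<^sub>C f z) \<and>
    (\<forall>z\<in>U. dbar (\<lambda>z. (z - z0) ^ n *\<^sub>C f z) z = (z - z0) ^ n *\<^sub>C dbar f z)"
proof (induction n)
  case 0
  show ?case using f by (simp add: scaleC_one)
next
  case (Suc n)
  let ?g = "\<lambda>z. (z - z0) ^ n *\<^sub>C f z"
  have eq: "(\<lambda>z. (z - z0) ^ Suc n *\<^sub>C f z) = (\<lambda>z. z *\<^sub>C ?g z + (- z0) *\<^sub>C ?g z)"
    by (simp add: fun_eq_iff scaleC_scaleC scaleC_add_left[symmetric] algebra_simps)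
  have s: "smooth_on U (\<lambda>z. z *\<^sub>C ?g z)" "smooth_on U (\<lambda>z. (- z0) *\<^sub>C ?g z)"
    using Suc smooth_on_scaleC_linear[OF U bounded_linear_ident] smooth_on_scaleC_const[OF U] by blast+
  have "dbar (\<lambda>z. (z - z0) ^ Suc n *\<^sub>C f z) z = (z - z0) ^ Suc n *\<^sub>C dbar f z" if "z \<in> U" for z
    unfolding eq dbar_add[OF s that]
    using dbar_power[of U ?g z 1] dbar_scaleC_const[of U ?g z "- z0"] Suc that
    by (simp add: scaleC_scaleC scaleC_add_left[symmetric] algebra_simps)
  moreover have "smooth_on U (\<lambda>z. (z - z0) ^ Suc n *\<^sub>C f z)"
    unfolding eq by (rule smooth_on_add[OF U s])
  ultimately show ?case by blast
qed

section \<open>Moments over circles and discs\<close>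

lemma continuous_on_circle:
  fixes f :: "complex \<Rightarrow> 'a::topological_space"
  assumes "continuous_on U f" "cball z0 R \<subseteq> U"
  shows "continuous_on ({0..R} \<times> {0..2*pi}) (\<lambda>(r, t). f (z0 + complex_of_real r * cis t))"
proof -
  have "continuous_on ({0..R} \<times> {0..2*pi}) (\<lambda>p. f (z0 + complex_of_real (fst p) * cis (snd p)))"
  proof (rule continuous_on_compose2[OF assms(1)])
    show "(\<lambda>p. z0 + complex_of_real (fst p) * cis (snd p)) ` ({0..R} \<times> {0..2*pi}) \<subseteq> U"
      using assms(2) by (auto simp: dist_norm norm_mult)
  qed (simp add: cis_conv_exp, intro continuous_intros)
  then show ?thesis by (simp add: split_beta)
qed

text \<open>Differential form of Green's formula: the dependence of a circle integral on the radius
  is governed by dbar alone. Every later estimate rests on this.\<close>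

lemma has_vector_derivative_circle_integral:
  fixes G :: "complex \<Rightarrow> 'a::chilbert_space"
  assumes U: "open U" and sub: "cball z0 R \<subseteq> U" and G: "smooth_on U G" and r: "0 < r" "r < R"
  shows "((\<lambda>r. integral {0..2*pi} (\<lambda>t. G (z0 + complex_of_real r * cis t))) has_vector_derivative
    integral {0..2*pi} (\<lambda>t. (2 * cis (- t)) *\<^sub>C dbar G (z0 + complex_of_real r * cis t))) (at r)"
proof -
  define p where "p = (\<lambda>r t. z0 + complex_of_real r * cis t)"
  define Gx where "Gx = pderiv_dir False G"
  define Gy where "Gy = pderiv_dir True G"
  define Gr where "Gr = (\<lambda>r t. cos t *\<^sub>R Gx (p r t) + sin t *\<^sub>R Gy (p r t))"
  define Gt where "Gt = (\<lambda>t. (- r * sin t) *\<^sub>R Gx (p r t) + (r * cos t) *\<^sub>R Gy (p r t))"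
  have pU: "p s t \<in> U" if "0 \<le> s" "s \<le> R" for s t
    using that sub by (auto simp: p_def dist_norm norm_mult)
  have der: "(G has_derivative (\<lambda>h. Re h *\<^sub>R Gx (p s t) + Im h *\<^sub>R Gy (p s t))) (at (p s t))"
    if "0 \<le> s" "s \<le> R" for s t
    unfolding Gx_def Gy_def by (rule smooth_on_has_derivative[OF U G pU[OF that]])
  have contG: "continuous_on ({0..R} \<times> {0..2*pi}) (\<lambda>(r, t). G (p r t))"
    unfolding p_def by (rule continuous_on_circle[OF smooth_on_imp_continuous_on[OF G] sub])
  have contGx: "continuous_on ({0..R} \<times> {0..2*pi}) (\<lambda>(r, t). Gx (p r t))"
    unfolding p_def Gx_def
    by (rule continuous_on_circle[OF smooth_on_imp_continuous_on[OF smooth_on_pderiv_dir[OF G]] sub])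
  have contGy: "continuous_on ({0..R} \<times> {0..2*pi}) (\<lambda>(r, t). Gy (p r t))"
    unfolding p_def Gy_def
    by (rule continuous_on_circle[OF smooth_on_imp_continuous_on[OF smooth_on_pderiv_dir[OF G]] sub])
  have contGr: "continuous_on ({0..R} \<times> {0..2*pi}) (\<lambda>(r, t). Gr r t)"
    using contGx contGy unfolding Gr_def split_beta by (intro continuous_intros)
  have slice: "continuous_on {0..2*pi} (\<lambda>t. f s t)"
    if "continuous_on ({0..R} \<times> {0..2*pi}) (\<lambda>(r, t). f r t)" "0 \<le> s" "s \<le> R"
    for f :: "real \<Rightarrow> real \<Rightarrow> 'a" and s
    by (rule continuous_on_compose2[OF that(1), of _ "\<lambda>t. (s, t)", simplified])
      (use that in \<open>auto intro!: continuous_intros\<close>)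
  have dr: "((\<lambda>s. G (p s t)) has_vector_derivative Gr s t) (at s)" if "0 < s" "s < R" for s t
  proof -
    have "((\<lambda>s. p s t) has_vector_derivative cis t) (at s)"
      unfolding p_def by (auto intro!: derivative_eq_intros)
    from vector_derivative_diff_chain_within[OF this, of G "\<lambda>h. Re h *\<^sub>R Gx (p s t) + Im h *\<^sub>R Gy (p s t)"]
    show ?thesis using der[of s t] that
      by (simp add: o_def Gr_def has_derivative_at_withinI)
  qed
  have dt: "((\<lambda>t. G (p r t)) has_vector_derivative Gt t) (at t)" for t
  proof -
    have "((\<lambda>t. p r t) has_vector_derivative complex_of_real r * (\<i> * cis t)) (at t)"
      unfolding p_def has_vector_derivative_def
      by (auto intro!: derivative_eq_intros ext simp: scaleR_conv_of_real)
    from vector_derivative_diff_chain_within[OF this, of G "\<lambda>h. Re h *\<^sub>R Gx (p r t) + Im h *\<^sub>R Gy (p r t)"]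
    show ?thesis using der[of r t] r
      by (simp add: o_def Gt_def has_derivative_at_withinI)
  qed
  have "((\<lambda>r. integral (cbox 0 (2*pi)) (\<lambda>t. G (p r t))) has_vector_derivative
      integral (cbox 0 (2*pi)) (Gr r)) (at r within {0<..<R})"
  proof (rule leibniz_rule_vector_derivative)
    show "((\<lambda>r. G (p r t)) has_vector_derivative Gr s t) (at s within {0<..<R})"
      if "s \<in> {0<..<R}" for s t
      using dr[of s t] that by (simp add: has_vector_derivative_at_within)
    show "(\<lambda>t. G (p s t)) integrable_on cbox 0 (2*pi)" if "s \<in> {0<..<R}" for s
      using slice[OF contG, of s] that by (simp add: integrable_continuous_real)
    show "continuous_on ({0<..<R} \<times> cbox 0 (2*pi)) (\<lambda>(x, t). Gr x t)"
      by (rule continuous_on_subset[OF contGr]) auto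
  qed (use r in auto)
  then have A: "((\<lambda>r. integral {0..2*pi} (\<lambda>t. G (p r t))) has_vector_derivative
      integral {0..2*pi} (Gr r)) (at r)"
    using r by (simp add: at_within_open[of r "{0<..<R}"])
  have Gt0: "(Gt has_integral 0) {0..2*pi}"
    using fundamental_theorem_of_calculus[of 0 "2*pi" "\<lambda>t. G (p r t)" Gt] dt
    by (simp add: has_vector_derivative_at_within p_def)
  \<comment> \<open>In polar coordinates \<open>2 e\<^bsup>-it\<^esup> dbar = \<partial>\<^sub>r + (\<i>/r) \<partial>\<^sub>t\<close>, and \<open>\<partial>\<^sub>t G\<close> integrates to 0 over the circle.\<close>
  have eq: "(2 * cis (- t)) *\<^sub>C dbar G (p r t) = Gr r t + (\<i> / complex_of_real r) *\<^sub>C Gt t" for t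
  proof -
    have cis: "cis (- t) = complex_of_real (cos t) + \<i> / complex_of_real r * complex_of_real (- r * sin t)"
      using r by (simp add: complex_eq_iff)
    have i_cis: "\<i> * cis (- t) = complex_of_real (sin t) + \<i> / complex_of_real r * complex_of_real (r * cos t)"
      using r by (simp add: complex_eq_iff)
    have "(2 * cis (- t)) *\<^sub>C dbar G (p r t) =
      cis (- t) *\<^sub>C Gx (p r t) + (\<i> * cis (- t)) *\<^sub>C Gy (p r t)"
      by (simp add: dbar_def scaleC_scaleC scaleC_add_right Gx_def Gy_def mult_ac)
    then show ?thesis
      unfolding i_cis unfolding cis Gr_def Gt_def
      by (simp only: scaleR_scaleC scaleC_add_left scaleC_add_right scaleC_scaleC add_ac)
  qed
  have "(Gr r has_integral integral {0..2*pi} (Gr r)) {0..2*pi}"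
    using slice[OF contGr, of r] r by (simp add: integrable_continuous_real integrable_integral)
  from has_integral_add[OF this has_integral_linear[OF Gt0 scaleC.bounded_linear_right[of "\<i> / complex_of_real r"]]]
  have "integral {0..2*pi} (\<lambda>t. (2 * cis (- t)) *\<^sub>C dbar G (p r t)) = integral {0..2*pi} (Gr r)"
    unfolding eq by (simp add: o_def scaleC.zero_right integral_unique)
  with A show ?thesis by (simp add: p_def)
qed

section \<open>Weighted moments, integration by parts and bounds\<close>

definition circle_moment :: "nat \<Rightarrow> (complex \<Rightarrow> 'a::chilbert_space) \<Rightarrow> complex \<Rightarrow> real \<Rightarrow> 'a" where
  "circle_moment i f z0 r =
     integral {0..2*pi} (\<lambda>t. (complex_of_real r * cis t) ^ i *\<^sub>C f (z0 + complex_of_real r * cis t))"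

text \<open>In polar coordinates and up to a factor 2, the area integral of \<open>f z\<close>
  against \<open>(R^2 - |z - z0|^2)^m (z - z0)^i\<close> over the disc of radius \<open>R\<close>
  about \<open>z0\<close>. The weight vanishes to order \<open>m\<close> on the boundary circle,
  which allows \<open>m\<close> integrations by parts; \<open>2 r\<close> is minus the derivative of
  \<open>R^2 - r^2\<close>.\<close>

definition disc_moment :: "real \<Rightarrow> nat \<Rightarrow> nat \<Rightarrow> (complex \<Rightarrow> 'a::chilbert_space) \<Rightarrow> complex \<Rightarrow> 'a" where
  "disc_moment R m i f z0 =
     integral {0..R} (\<lambda>r. ((R\<^sup>2 - r\<^sup>2) ^ m * (2 * r)) *\<^sub>R circle_moment i f z0 r)"

lemma continuous_on_circle_moment_integrand:
  fixes f :: "complex \<Rightarrow> 'a::chilbert_space"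
  assumes "continuous_on U f" "cball z0 R \<subseteq> U"
  shows "continuous_on ({0..R} \<times> {0..2*pi})
    (\<lambda>(r, t). (complex_of_real r * cis t) ^ i *\<^sub>C f (z0 + complex_of_real r * cis t))"
proof -
  have "continuous_on U (\<lambda>z. (z - z0) ^ i *\<^sub>C f z)"
    by (intro scaleC.continuous_on assms(1) continuous_intros)
  from continuous_on_circle[OF this assms(2)] show ?thesis by simp
qed

lemma continuous_on_circle_moment_integrand_slice:
  fixes f :: "complex \<Rightarrow> 'a::chilbert_space"
  assumes "continuous_on U f" "cball z0 R \<subseteq> U" "0 \<le> r" "r \<le> R"
  shows "continuous_on {0..2*pi} (\<lambda>t. (complex_of_real r * cis t) ^ i *\<^sub>C f (z0 + complex_of_real r * cis t))"
  by (rule continuous_on_compose2[OF continuous_on_circle_moment_integrand[OF assms(1,2)],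
        of _ "\<lambda>t. (r, t)", simplified])
    (use assms in \<open>auto intro!: continuous_intros\<close>)

lemma continuous_on_circle_moment:
  fixes f :: "complex \<Rightarrow> 'a::chilbert_space"
  assumes "continuous_on U f" "cball z0 R \<subseteq> U"
  shows "continuous_on {0..R} (circle_moment i f z0)"
  using integral_continuous_on_param[of "{0..R}" 0 "2*pi"
      "\<lambda>r t. (complex_of_real r * cis t) ^ i *\<^sub>C f (z0 + complex_of_real r * cis t)"]
    continuous_on_circle_moment_integrand[OF assms, of i]
  by (simp add: circle_moment_def[abs_def])

lemma continuous_on_disc_moment_integrand:
  fixes f :: "complex \<Rightarrow> 'a::chilbert_space"
  assumes "continuous_on U f" "cball z0 R \<subseteq> U"
  shows "continuous_on {0..R} (\<lambda>r. ((R\<^sup>2 - r\<^sup>2) ^ m * (2 * r)) *\<^sub>R circle_moment i f z0 r)"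
  by (intro continuous_intros continuous_on_circle_moment[OF assms])

text \<open>The circle integral formula is applied to \<open>(z - z0) ^ Suc i *\<^sub>C f z\<close>.
  The holomorphic factor commutes with dbar, and \<open>2 * cis (- t)\<close> turns one factor
  \<open>r * cis t\<close> into \<open>2 * r\<close>.\<close>

lemma has_vector_derivative_circle_moment:
  fixes f :: "complex \<Rightarrow> 'a::chilbert_space"
  assumes U: "open U" and sub: "cball z0 R \<subseteq> U" and f: "smooth_on U f" and r: "0 < r" "r < R"
  shows "(circle_moment (Suc i) f z0 has_vector_derivative
    (2 * r) *\<^sub>R circle_moment i (dbar f) z0 r) (at r)"
proof -
  let ?G = "\<lambda>z. (z - z0) ^ Suc i *\<^sub>C f z"
  let ?p = "\<lambda>t. z0 + complex_of_real r * cis t"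
  have G: "smooth_on U ?G" and dG: "\<And>z. z \<in> U \<Longrightarrow> dbar ?G z = (z - z0) ^ Suc i *\<^sub>C dbar f z"
    using smooth_on_dbar_power_centred[OF U f] by blast+
  have pU: "?p t \<in> U" for t
    using sub r by (auto simp: dist_norm norm_mult)
  have eq: "(2 * cis (- t)) *\<^sub>C dbar ?G (?p t) =
      (2 * r) *\<^sub>R ((complex_of_real r * cis t) ^ i *\<^sub>C dbar f (?p t))" for t
  proof -
    have "cis (- t) * cis t = 1" by (simp add: cis_mult)
    then have "2 * cis (- t) * (complex_of_real r * cis t) ^ Suc i =
      complex_of_real (2 * r) * (complex_of_real r * cis t) ^ i"
      by (simp add: mult_ac)
    then show ?thesis
      by (simp only: dG[OF pU] add_diff_cancel_left' scaleR_scaleC scaleC_scaleC)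
  qed
  have "(2 * r) *\<^sub>R circle_moment i (dbar f) z0 r = integral {0..2*pi} (\<lambda>t. (2 * cis (- t)) *\<^sub>C dbar ?G (?p t))"
    unfolding eq circle_moment_def by simp
  moreover have "circle_moment (Suc i) f z0 = (\<lambda>r. integral {0..2*pi} (\<lambda>t. ?G (z0 + complex_of_real r * cis t)))"
    by (simp add: circle_moment_def[abs_def])
  ultimately show ?thesis
    using has_vector_derivative_circle_integral[OF U sub G r] by simp
qed

lemma has_real_derivative_disc_weight:
  "((\<lambda>r. (R\<^sup>2 - r\<^sup>2) ^ Suc m) has_real_derivative - (real (Suc m) * ((R\<^sup>2 - r\<^sup>2) ^ m * (2 * r)))) (at r within S)"
proof -
  have "((\<lambda>r. R\<^sup>2 - r\<^sup>2) has_real_derivative - (2 * r)) (at r within S)"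
    by (auto intro!: derivative_eq_intros)
  from DERIV_power_Suc[OF this, of m] show ?thesis by (simp add: algebra_simps)
qed

text \<open>Integration by parts in the radius. Both boundary terms vanish: at \<open>R\<close> the
  weight has the positive exponent \<open>Suc m\<close>, at 0 the circle moment has the positive
  order \<open>Suc i\<close>.\<close>

lemma disc_moment_dbar:
  fixes f :: "complex \<Rightarrow> 'a::chilbert_space"
  assumes U: "open U" and sub: "cball z0 R \<subseteq> U" and R: "0 < R" and f: "smooth_on U f"
  shows "disc_moment R (Suc m) i (dbar f) z0 = real (Suc m) *\<^sub>R disc_moment R m (Suc i) f z0"
proof -
  let ?H = "\<lambda>r. (R\<^sup>2 - r\<^sup>2) ^ Suc m *\<^sub>R circle_moment (Suc i) f z0 r"
  let ?a = "\<lambda>r. ((R\<^sup>2 - r\<^sup>2) ^ Suc m * (2 * r)) *\<^sub>R circle_moment i (dbar f) z0 r"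
  let ?b = "\<lambda>r. ((R\<^sup>2 - r\<^sup>2) ^ m * (2 * r)) *\<^sub>R circle_moment (Suc i) f z0 r"
  have cf: "continuous_on U f" "continuous_on U (dbar f)"
    using smooth_on_imp_continuous_on smooth_on_dbar[OF U] f by blast+
  have "(?H has_vector_derivative (?a r - real (Suc m) *\<^sub>R ?b r)) (at r)" if "r \<in> {0<..<R}" for r
  proof -
    from has_vector_derivative_scaleR[OF has_real_derivative_disc_weight
        has_vector_derivative_circle_moment[OF U sub f]] that
    show ?thesis by (simp add: algebra_simps)
  qed
  moreover have "continuous_on {0..R} ?H"
    by (intro continuous_intros continuous_on_circle_moment[OF cf(1) sub])
  \<comment> \<open>The derivative is known for \<open>0 < r < R\<close>; at the two ends continuity
    is enough for this form of the fundamental theorem.\<close>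
  ultimately have "((\<lambda>r. ?a r - real (Suc m) *\<^sub>R ?b r) has_integral (?H R - ?H 0)) {0..R}"
    using R by (intro fundamental_theorem_of_calculus_interior) auto
  moreover have "circle_moment (Suc i) f z0 0 = 0"
    by (simp add: circle_moment_def scaleC.zero_left)
  ultimately have "integral {0..R} (\<lambda>r. ?a r - real (Suc m) *\<^sub>R ?b r) = 0"
    by (simp add: integral_unique)
  moreover have "integral {0..R} (\<lambda>r. ?a r - real (Suc m) *\<^sub>R ?b r) =
      integral {0..R} ?a - integral {0..R} (\<lambda>r. real (Suc m) *\<^sub>R ?b r)"
    by (intro integral_diff integrable_continuous_real continuous_on_scaleR continuous_on_const
        continuous_on_disc_moment_integrand[OF cf(1) sub] continuous_on_disc_moment_integrand[OF cf(2) sub])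
  ultimately show ?thesis
    unfolding disc_moment_def integral_cmul by simp
qed

lemma disc_moment_add:
  fixes f g :: "complex \<Rightarrow> 'a::chilbert_space"
  assumes sub: "cball z0 R \<subseteq> U" and f: "continuous_on U f" and g: "continuous_on U g"
  shows "disc_moment R m i (\<lambda>z. f z + g z) z0 = disc_moment R m i f z0 + disc_moment R m i g z0"
proof -
  have "circle_moment i (\<lambda>z. f z + g z) z0 r = circle_moment i f z0 r + circle_moment i g z0 r"
    if "r \<in> {0..R}" for r
    unfolding circle_moment_def scaleC_add_right using that
    by (intro integral_add integrable_continuous_real
        continuous_on_circle_moment_integrand_slice[OF f sub]
        continuous_on_circle_moment_integrand_slice[OF g sub]) auto
  then have "disc_moment R m i (\<lambda>z. f z + g z) z0 =
    integral {0..R} (\<lambda>r. ((R\<^sup>2 - r\<^sup>2) ^ m * (2 * r)) *\<^sub>R circle_moment i f z0 r +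
      ((R\<^sup>2 - r\<^sup>2) ^ m * (2 * r)) *\<^sub>R circle_moment i g z0 r)"
    unfolding disc_moment_def by (intro Henstock_Kurzweil_Integration.integral_cong) (simp add: scaleR_right_distrib)
  also have "\<dots> = disc_moment R m i f z0 + disc_moment R m i g z0"
    unfolding disc_moment_def
    by (intro integral_add integrable_continuous_real
        continuous_on_disc_moment_integrand[OF f sub] continuous_on_disc_moment_integrand[OF g sub])
  finally show ?thesis .
qed

text \<open>Stated for a general function of the radius, because it is applied to circle moments and
  also to their deviation from the value at the centre.\<close>

lemma norm_disc_moment_integral_le:
  fixes F :: "real \<Rightarrow> 'a::chilbert_space"
  assumes R: "0 < R" and F: "continuous_on {0..R} F" and B: "\<And>r. r \<in> {0..R} \<Longrightarrow> norm (F r) \<le> B"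
  shows "norm (integral {0..R} (\<lambda>r. ((R\<^sup>2 - r\<^sup>2) ^ m * (2 * r)) *\<^sub>R F r)) \<le> (R\<^sup>2) ^ m * (2 * R) * B * R"
proof -
  have "norm (((R\<^sup>2 - r\<^sup>2) ^ m * (2 * r)) *\<^sub>R F r) \<le> (R\<^sup>2) ^ m * (2 * R) * B" if r: "r \<in> {0..R}" for r
  proof -
    have "r\<^sup>2 \<le> R\<^sup>2" using r by (simp add: power_mono)
    then have "(R\<^sup>2 - r\<^sup>2) ^ m \<le> (R\<^sup>2) ^ m" "0 \<le> (R\<^sup>2 - r\<^sup>2) ^ m"
      by (auto intro!: power_mono)
    then have "\<bar>(R\<^sup>2 - r\<^sup>2) ^ m * (2 * r)\<bar> \<le> (R\<^sup>2) ^ m * (2 * R)"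
      unfolding abs_mult using r by (intro mult_mono) auto
    then show ?thesis
      unfolding norm_scaleR using B[OF r] R by (intro mult_mono) auto
  qed
  then have "norm (integral {0..R} (\<lambda>r. ((R\<^sup>2 - r\<^sup>2) ^ m * (2 * r)) *\<^sub>R F r)) \<le> (R\<^sup>2) ^ m * (2 * R) * B * (R - 0)"
    using R by (intro integral_bound continuous_intros F) auto
  then show ?thesis by simp
qed

lemma norm_circle_moment_le:
  fixes f :: "complex \<Rightarrow> 'a::chilbert_space"
  assumes sub: "cball z0 R \<subseteq> U" and f: "continuous_on U f"
    and B: "\<And>z. z \<in> cball z0 R \<Longrightarrow> norm (f z) \<le> B" and r: "r \<in> {0..R}"
  shows "norm (circle_moment i f z0 r) \<le> R ^ i * B * (2 * pi)"
proof -
  have "norm ((complex_of_real r * cis t) ^ i *\<^sub>C f (z0 + complex_of_real r * cis t)) \<le> R ^ i * B" for t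
  proof -
    have "norm (f (z0 + complex_of_real r * cis t)) \<le> B"
      using r by (intro B) (auto simp: dist_norm norm_mult)
    then show ?thesis
      unfolding norm_scaleC norm_power norm_mult using r
      by (intro mult_mono power_mono) auto
  qed
  then have "norm (circle_moment i f z0 r) \<le> R ^ i * B * (2 * pi - 0)"
    unfolding circle_moment_def using r
    by (intro integral_bound continuous_on_circle_moment_integrand_slice[OF f sub]) auto
  then show ?thesis by simp
qed

text \<open>The constant depends on \<open>R\<close>, \<open>m\<close> and \<open>i\<close> alone,
  hence serves all centres and all members of a sequence at once.\<close>

lemma norm_disc_moment_le:
  assumes "0 < R"
  obtains C where "\<And>(f :: complex \<Rightarrow> 'a::chilbert_space) U z0 B. cball z0 R \<subseteq> U \<Longrightarrow> continuous_on U f \<Longrightarrow>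
    (\<And>z. z \<in> cball z0 R \<Longrightarrow> norm (f z) \<le> B) \<Longrightarrow> norm (disc_moment R m i f z0) \<le> C * B"
proof
  fix f :: "complex \<Rightarrow> 'a" and U z0 B
  assume sub: "cball z0 R \<subseteq> U" and f: "continuous_on U f"
    and B: "\<And>z. z \<in> cball z0 R \<Longrightarrow> norm (f z) \<le> B"
  have "norm (disc_moment R m i f z0) \<le> (R\<^sup>2) ^ m * (2 * R) * (R ^ i * B * (2 * pi)) * R"
    unfolding disc_moment_def
    by (intro norm_disc_moment_integral_le assms continuous_on_circle_moment[OF f sub]
        norm_circle_moment_le[OF sub f B])
  then show "norm (disc_moment R m i f z0) \<le> (R\<^sup>2) ^ m * (2 * R) * R ^ i * (2 * pi) * R * B"
    by (simp add: mult_ac)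
qed

text \<open>Approximate mean value property. At radius 0 the circle integral is
  \<open>(2 * pi) *\<^sub>R f z0\<close>, and its radial derivative is at most \<open>2 * B\<close>
  times the angle \<open>2 * pi\<close>.\<close>

lemma norm_circle_moment_diff_le:
  fixes f :: "complex \<Rightarrow> 'a::chilbert_space"
  assumes U: "open U" and sub: "cball z0 R \<subseteq> U" and f: "smooth_on U f"
    and B: "\<And>z. z \<in> cball z0 R \<Longrightarrow> norm (dbar f z) \<le> B" and r: "r \<in> {0..R}"
  shows "norm (circle_moment 0 f z0 r - (2 * pi) *\<^sub>R f z0) \<le> 4 * pi * R * B"
proof -
  have cf: "continuous_on U f" "continuous_on U (dbar f)"
    using smooth_on_imp_continuous_on smooth_on_dbar[OF U] f by blast+
  have M0: "circle_moment 0 f z0 = (\<lambda>r. integral {0..2*pi} (\<lambda>t. f (z0 + complex_of_real r * cis t)))"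
    by (simp add: circle_moment_def[abs_def] scaleC_one)
  have "0 \<le> norm (dbar f z0)" by simp
  also have "\<dots> \<le> B" using r by (intro B) auto
  finally have B0: "0 \<le> B" .
  have eq: "(2 * pi) *\<^sub>R f z0 = circle_moment 0 f z0 0"
    by (simp add: M0)
  show ?thesis
  proof (cases "r = 0")
    case True
    then show ?thesis using B0 r by (simp add: eq)
  next
    case False
    have "norm (circle_moment 0 f z0 r - circle_moment 0 f z0 0) \<le> 4 * pi * B * r - 4 * pi * B * 0"
    proof (rule differentiable_bound_general)
      show "0 < r" using r False by auto
      show "continuous_on {0..r} (circle_moment 0 f z0)"
        using continuous_on_subset[OF continuous_on_circle_moment[OF cf(1) sub]] r by auto
      show "continuous_on {0..r} ((*) (4 * pi * B))" by (intro continuous_intros)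
      fix s assume s: "0 < s" "s < r"
      have sR: "s < R" using s r by auto
      show "(circle_moment 0 f z0 has_vector_derivative
          integral {0..2*pi} (\<lambda>t. (2 * cis (- t)) *\<^sub>C dbar f (z0 + complex_of_real s * cis t))) (at s)"
        unfolding M0 by (rule has_vector_derivative_circle_integral[OF U sub f s(1) sR])
      show "((*) (4 * pi * B) has_vector_derivative 4 * pi * B) (at s)"
        by (auto intro!: derivative_eq_intros)
      have "continuous_on {0..2*pi} (\<lambda>t. dbar f (z0 + complex_of_real s * cis t))"
        using continuous_on_circle_moment_integrand_slice[OF cf(2) sub, of s 0] s sR
        by (simp add: scaleC_one)
      then have "continuous_on {0..2*pi} (\<lambda>t. (2 * cis (- t)) *\<^sub>C dbar f (z0 + complex_of_real s * cis t))"
        by (intro scaleC.continuous_on continuous_on_mult continuous_on_const)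
          (simp add: cis_conv_exp, intro continuous_intros)
      moreover have "norm ((2 * cis (- t)) *\<^sub>C dbar f (z0 + complex_of_real s * cis t)) \<le> 2 * B" for t
        using B[of "z0 + complex_of_real s * cis t"] s sR by (simp add: norm_scaleC norm_mult dist_norm)
      ultimately have "norm (integral {0..2*pi} (\<lambda>t. (2 * cis (- t)) *\<^sub>C dbar f (z0 + complex_of_real s * cis t)))
         \<le> 2 * B * (2 * pi - 0)"
        by (intro integral_bound) auto
      then show "norm (integral {0..2*pi} (\<lambda>t. (2 * cis (- t)) *\<^sub>C dbar f (z0 + complex_of_real s * cis t)))
         \<le> 4 * pi * B"
        by (simp add: mult_ac)
    qed
    also have "\<dots> \<le> 4 * pi * R * B"
      using r B0 by (simp add: mult_left_mono mult.commute mult_right_mono)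
    finally show ?thesis unfolding eq .
  qed
qed

text \<open>The elliptic estimate for dbar. Replacing the circle integrals inside the disc moment by
  \<open>(2 * pi) *\<^sub>R f z0\<close> gives a positive multiple of \<open>f z0\<close>; the error
  is controlled by \<open>B\<close>.\<close>

lemma norm_le_disc_moment_dbar:
  assumes R: "0 < R"
  obtains C where "C \<ge> 0" "\<And>(f :: complex \<Rightarrow> 'a::chilbert_space) U z0 B. open U \<Longrightarrow> cball z0 R \<subseteq> U \<Longrightarrow>
    smooth_on U f \<Longrightarrow> (\<And>z. z \<in> cball z0 R \<Longrightarrow> norm (dbar f z) \<le> B) \<Longrightarrow>
    norm (f z0) \<le> C * (norm (disc_moment R m 0 f z0) + B)"
proof -
  \<comment> \<open>\<open>c\<close> is \<open>2 * pi\<close> times the integral of the radial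
    weight over \<open>{0..R}\<close>.\<close>
  define c where "c = (R\<^sup>2) ^ Suc m / real (Suc m) * (2 * pi)"
  \<comment> \<open>The second entry is the factor of \<open>B\<close> in the error; the maximum
    with 1 lets \<open>K\<close> dominate the coefficient of the disc moment too.\<close>
  define K where "K = max 1 ((R\<^sup>2) ^ m * (2 * R) * (4 * pi * R) * R)"
  have c: "c > 0" using R by (simp add: c_def)
  have est: "norm (f z0) \<le> K / c * (norm (disc_moment R m 0 f z0) + B)"
    if U: "open U" and sub: "cball z0 R \<subseteq> U" and f: "smooth_on U f"
      and B: "\<And>z. z \<in> cball z0 R \<Longrightarrow> norm (dbar f z) \<le> B"
    for f :: "complex \<Rightarrow> 'a" and U z0 B
  proof -
    have "0 \<le> norm (dbar f z0)" by simp
    also have "\<dots> \<le> B" using R by (intro B) auto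
    finally have B0: "0 \<le> B" .
    have cf: "continuous_on U f" by (rule smooth_on_imp_continuous_on[OF f])
    let ?w = "\<lambda>r. (R\<^sup>2 - r\<^sup>2) ^ m * (2 * r)"
    have "((\<lambda>r. - 1 / real (Suc m) * (R\<^sup>2 - r\<^sup>2) ^ Suc m) has_real_derivative ?w r) (at r within {0..R})" for r
      using DERIV_cmult[OF has_real_derivative_disc_weight, of "- 1 / real (Suc m)" R m r "{0..R}"]
      by (simp del: power_Suc of_nat_Suc)
    then have "(?w has_integral (- 1 / real (Suc m) * (R\<^sup>2 - R\<^sup>2) ^ Suc m
        - - 1 / real (Suc m) * (R\<^sup>2 - 0\<^sup>2) ^ Suc m)) {0..R}"
      using R by (intro fundamental_theorem_of_calculus)
        (auto simp flip: has_real_derivative_iff_has_vector_derivative)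
    then have "(?w has_integral (R\<^sup>2) ^ Suc m / real (Suc m)) {0..R}" by simp
    from has_integral_scaleR_left[OF this, of "(2 * pi) *\<^sub>R f z0"]
    have const: "((\<lambda>r. ?w r *\<^sub>R ((2 * pi) *\<^sub>R f z0)) has_integral c *\<^sub>R f z0) {0..R}"
      by (simp add: c_def)
    have "(\<lambda>r. ?w r *\<^sub>R circle_moment 0 f z0 r) integrable_on {0..R}"
      by (intro integrable_continuous_real continuous_on_disc_moment_integrand[OF cf sub])
    then have "disc_moment R m 0 f z0 - c *\<^sub>R f z0 =
      integral {0..R} (\<lambda>r. ?w r *\<^sub>R circle_moment 0 f z0 r - ?w r *\<^sub>R ((2 * pi) *\<^sub>R f z0))"
      using const by (simp add: disc_moment_def integral_diff integral_unique has_integral_integrable)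
    also have "\<dots> = integral {0..R} (\<lambda>r. ?w r *\<^sub>R (circle_moment 0 f z0 r - (2 * pi) *\<^sub>R f z0))"
      by (simp add: scaleR_right_diff_distrib)
    also have "norm \<dots> \<le> (R\<^sup>2) ^ m * (2 * R) * (4 * pi * R * B) * R"
      by (intro norm_disc_moment_integral_le R continuous_intros continuous_on_circle_moment[OF cf sub]
          norm_circle_moment_diff_le[OF U sub f B])
    also have "\<dots> = ((R\<^sup>2) ^ m * (2 * R) * (4 * pi * R) * R) * B" by (simp add: mult_ac)
    also have "\<dots> \<le> K * B" using B0 by (intro mult_right_mono) (auto simp: K_def)
    finally have "norm (disc_moment R m 0 f z0 - c *\<^sub>R f z0) \<le> K * B" .
    then have "norm (c *\<^sub>R f z0) \<le> norm (disc_moment R m 0 f z0) + K * B"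
      using norm_triangle_ineq4[of "disc_moment R m 0 f z0" "disc_moment R m 0 f z0 - c *\<^sub>R f z0"] by simp
    also have "norm (disc_moment R m 0 f z0) \<le> K * norm (disc_moment R m 0 f z0)"
      using mult_right_mono[of 1 K "norm (disc_moment R m 0 f z0)"] by (simp add: K_def)
    finally have "c * norm (f z0) \<le> K * (norm (disc_moment R m 0 f z0) + B)"
      using c by (simp add: algebra_simps)
    then show ?thesis using c by (simp add: field_simps)
  qed
  have "K / c \<ge> 0" using c by (simp add: K_def)
  then show thesis by (rule that) (rule est)
qed

section \<open>Null sequences and weakly null sequences\<close>

text \<open>Convergence of the values only, without derivatives; smoothness is included so that dbar
  can be applied to every member.\<close>

definition null_on :: "complex set \<Rightarrow> (nat \<Rightarrow> complex \<Rightarrow> 'a::real_normed_vector) \<Rightarrow> bool" where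
  "null_on U f \<longleftrightarrow> (\<forall>k. smooth_on U (f k)) \<and>
     (\<forall>K. compact K \<and> K \<subseteq> U \<longrightarrow> uniform_limit K f (\<lambda>_. 0) sequentially)"

lemma null_on_smooth: "null_on U f \<Longrightarrow> smooth_on U (f k)"
  by (simp add: null_on_def)

lemma null_on_uniform_limit:
  "null_on U f \<Longrightarrow> compact K \<Longrightarrow> K \<subseteq> U \<Longrightarrow> uniform_limit K f (\<lambda>_. 0) sequentially"
  by (simp add: null_on_def)

text \<open>The constant may depend on the compact set but not on \<open>k\<close>. Most closure
  properties of null sequences are instances.\<close>

lemma null_on_dominated:
  assumes f: "null_on U f" and g: "\<And>k. smooth_on U (g k)"
    and dom: "\<And>K. compact K \<Longrightarrow> K \<subseteq> U \<Longrightarrow> \<exists>C. \<forall>z\<in>K. \<forall>k. norm (g k z) \<le> C * norm (f k z)"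
  shows "null_on U g"
  unfolding null_on_def
proof (intro conjI allI impI)
  fix K :: "complex set" assume K: "compact K \<and> K \<subseteq> U"
  obtain C where "\<forall>z\<in>K. \<forall>k. norm (g k z) \<le> C * norm (f k z)"
    using dom[OF conjunct1[OF K] conjunct2[OF K]] by (elim exE)
  then have C: "\<And>z k. z \<in> K \<Longrightarrow> norm (g k z) \<le> C * norm (f k z)" by simp
  show "uniform_limit K g (\<lambda>_. 0) sequentially"
  proof (rule uniform_limitI)
    fix e :: real assume e: "e > 0"
    \<comment> \<open>Adding 1 to the absolute value keeps the denominator positive, whatever
      \<open>C\<close> is.\<close>
    define d where "d = e / (\<bar>C\<bar> + 1)"
    have d: "d > 0" using e by (simp add: d_def add_nonneg_pos)
    have "\<forall>\<^sub>F k in sequentially. \<forall>z\<in>K. dist (f k z) 0 < d"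
      using uniform_limitD[OF null_on_uniform_limit[OF f] d] K by blast
    then show "\<forall>\<^sub>F k in sequentially. \<forall>z\<in>K. dist (g k z) 0 < e"
    proof eventually_elim
      case (elim k)
      show ?case
      proof
        fix z assume z: "z \<in> K"
        have "norm (g k z) \<le> C * norm (f k z)" by (rule C[OF z])
        also have "\<dots> \<le> (\<bar>C\<bar> + 1) * norm (f k z)" by (intro mult_right_mono) auto
        also have "\<dots> < (\<bar>C\<bar> + 1) * d" using elim z by (intro mult_strict_left_mono) auto
        also have "\<dots> = e" by (simp add: d_def field_simps)
        finally show "dist (g k z) 0 < e" by simp
      qed
    qed
  qed
qed (rule g)

lemma null_on_cong:
  assumes U: "open U" and f: "null_on U f" and eq: "\<And>k z. z \<in> U \<Longrightarrow> f k z = g k z"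
  shows "null_on U g"
proof (rule null_on_dominated[OF f])
  show "smooth_on U (g k)" for k
    using smooth_on_cong[OF U eq] null_on_smooth[OF f] by simp
  show "\<exists>C. \<forall>z\<in>K. \<forall>k. norm (g k z) \<le> C * norm (f k z)" if "compact K" "K \<subseteq> U" for K
    using eq that(2) by (intro exI[of _ 1]) (auto simp: subset_iff)
qed

lemma null_on_bounded_linear:
  assumes U: "open U" and L: "bounded_linear L" and f: "null_on U f"
  shows "null_on U (\<lambda>k z. L (f k z))"
proof (rule null_on_dominated[OF f])
  show "smooth_on U (\<lambda>z. L (f k z))" for k
    by (rule smooth_on_bounded_linear[OF U L null_on_smooth[OF f]])
  show "\<exists>C. \<forall>z\<in>K. \<forall>k. norm (L (f k z)) \<le> C * norm (f k z)" for K
    using bounded_linear.bounded[OF L] by (metis mult.commute)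
qed

lemma null_on_add:
  assumes "open U" "null_on U f" "null_on U g"
  shows "null_on U (\<lambda>k z. f k z + g k z)"
  unfolding null_on_def
proof (intro conjI allI impI)
  fix K assume K: "compact K \<and> K \<subseteq> U"
  then have "uniform_limit K (\<lambda>k z. f k z + g k z) (\<lambda>_. 0 + 0) sequentially"
    using assms by (intro uniform_limit_add null_on_uniform_limit) auto
  then show "uniform_limit K (\<lambda>k z. f k z + g k z) (\<lambda>_. 0) sequentially" by simp
qed (use assms in \<open>intro smooth_on_add null_on_smooth\<close>)

lemma null_on_scaleC_linear:
  fixes f :: "nat \<Rightarrow> complex \<Rightarrow> 'a::complex_inner"
  assumes U: "open U" and \<phi>: "bounded_linear \<phi>" and f: "null_on U f"
  shows "null_on U (\<lambda>k z. \<phi> z *\<^sub>C f k z)"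
proof (rule null_on_dominated[OF f])
  show "smooth_on U (\<lambda>z. \<phi> z *\<^sub>C f k z)" for k
    by (rule smooth_on_scaleC_linear[OF U \<phi> null_on_smooth[OF f]])
  fix K :: "complex set" assume "compact K" "K \<subseteq> U"
  then have "bounded (\<phi> ` K)"
    by (intro compact_imp_bounded compact_continuous_image linear_continuous_on \<phi>)
  then obtain C where "\<And>z. z \<in> K \<Longrightarrow> norm (\<phi> z) \<le> C"
    unfolding bounded_iff by auto
  then show "\<exists>C. \<forall>z\<in>K. \<forall>k. norm (\<phi> z *\<^sub>C f k z) \<le> C * norm (f k z)"
    by (intro exI[of _ C]) (auto simp: norm_scaleC mult_right_mono)
qed

section \<open>Weakly null sequences\<close>

text \<open>Unfolding the recursion, \<open>weak_null m U f\<close> says that \<open>f = a\<^sub>0 + dbar a\<^sub>1 + \<dots> + dbar\<^sup>m a\<^sub>m\<close> with null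
  sequences \<open>a\<^sub>i\<close>, that is, f tends to 0 in a negative Sobolev sense.\<close>
fun weak_null :: "nat \<Rightarrow> complex set \<Rightarrow> (nat \<Rightarrow> complex \<Rightarrow> 'a::complex_inner) \<Rightarrow> bool" where
  "weak_null 0 U f = null_on U f"
| "weak_null (Suc m) U f = ((\<forall>k. smooth_on U (f k)) \<and>
     (\<exists>a b. null_on U a \<and> weak_null m U b \<and> (\<forall>k. \<forall>z\<in>U. f k z = a k z + dbar (b k) z)))"

lemma weak_null_smooth: "weak_null m U f \<Longrightarrow> smooth_on U (f k)"
  by (cases m) (auto simp: null_on_smooth)

text \<open>The smoothness of \<open>f k\<close> that the recursion demands is read off from the
  decomposition.\<close>

lemma weak_null_SucI:
  assumes "open U" "null_on U a" "weak_null m U b" "\<And>k z. z \<in> U \<Longrightarrow> f k z = a k z + dbar (b k) z"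
  shows "weak_null (Suc m) U f"
proof -
  have "smooth_on U (\<lambda>z. a k z + dbar (b k) z)" for k
    using assms by (intro smooth_on_add smooth_on_dbar null_on_smooth weak_null_smooth)
  then have "smooth_on U (f k)" for k
    using smooth_on_cong[OF assms(1), of "f k" "\<lambda>z. a k z + dbar (b k) z" for k] assms(4) by blast
  then show ?thesis using assms by auto
qed

lemma weak_null_cong:
  assumes "open U" "weak_null m U f" "\<And>k z. z \<in> U \<Longrightarrow> f k z = g k z"
  shows "weak_null m U g"
proof (cases m)
  case 0
  then show ?thesis using null_on_cong[OF assms(1)] assms(2,3) by auto
next
  case (Suc m')
  then obtain a b where "null_on U a" "weak_null m' U b" "\<And>k z. z \<in> U \<Longrightarrow> f k z = a k z + dbar (b k) z"
    using assms(2) by auto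
  then show ?thesis unfolding Suc using assms(3)
    by (intro weak_null_SucI[OF assms(1)]) auto
qed

lemma null_on_zero: "open U \<Longrightarrow> null_on U f \<Longrightarrow> null_on U (\<lambda>k z. 0::'a::real_normed_vector)"
  by (rule null_on_bounded_linear[where L="\<lambda>x. 0"]) auto

lemma weak_null_Suc:
  assumes "open U" "weak_null m U f"
  shows "weak_null (Suc m) U f"
  using assms(2)
proof (induction m arbitrary: f)
  case 0
  have "null_on U (\<lambda>k z. 0::'a)" using null_on_zero[OF assms(1)] 0 by auto
  moreover from this have "dbar (\<lambda>z. 0::'a) z = 0" if "z \<in> U" for z
    using dbar_scaleC_const[OF null_on_smooth that, of "\<lambda>k z. 0" 0 0] by (simp add: scaleC.zero_left)
  ultimately show ?case using 0 assms(1)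
    by (intro weak_null_SucI[of _ f _ "\<lambda>k z. 0"]) auto
next
  case (Suc m)
  then obtain a b where ab: "null_on U a" "weak_null m U b" "\<And>k z. z \<in> U \<Longrightarrow> f k z = a k z + dbar (b k) z"
    by auto
  show ?case by (rule weak_null_SucI[OF assms(1) ab(1) Suc.IH[OF ab(2)] ab(3)])
qed

text \<open>One application of dbar costs one order: the null part of the new decomposition is
  0.\<close>

lemma weak_null_dbar:
  assumes "open U" "weak_null m U f"
  shows "weak_null (Suc m) U (\<lambda>k. dbar (f k))"
proof -
  obtain g :: "nat \<Rightarrow> complex \<Rightarrow> 'a" where "null_on U g"
    using assms(2) by (cases m) auto
  from null_on_zero[OF assms(1) this] have "null_on U (\<lambda>k z. 0::'a)" .
  then show ?thesis using assms by (intro weak_null_SucI) auto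
qed

lemma weak_null_add:
  assumes "open U" "weak_null m U f" "weak_null m U g"
  shows "weak_null m U (\<lambda>k z. f k z + g k z)"
  using assms(2,3)
proof (induction m arbitrary: f g)
  case 0
  then show ?case using null_on_add[OF assms(1)] by simp
next
  case (Suc m)
  obtain a b where 1: "null_on U a" "weak_null m U b" "\<And>k z. z \<in> U \<Longrightarrow> f k z = a k z + dbar (b k) z"
    using Suc.prems by auto
  obtain a' b' where 2: "null_on U a'" "weak_null m U b'" "\<And>k z. z \<in> U \<Longrightarrow> g k z = a' k z + dbar (b' k) z"
    using Suc.prems by auto
  show ?case
    by (rule weak_null_SucI[OF assms(1) null_on_add[OF assms(1) 1(1) 2(1)] Suc.IH[OF 1(2) 2(2)]])
      (subst dbar_add[OF weak_null_smooth[OF 1(2)] weak_null_smooth[OF 2(2)]]; simp add: 1(3) 2(3))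
qed

lemma weak_null_scaleC:
  assumes "open U" "weak_null m U f"
  shows "weak_null m U (\<lambda>k z. c *\<^sub>C f k z)"
  using assms(2)
proof (induction m arbitrary: f)
  case 0
  then show ?case using null_on_bounded_linear[OF assms(1) scaleC.bounded_linear_right] by simp
next
  case (Suc m)
  obtain a b where 1: "null_on U a" "weak_null m U b" "\<And>k z. z \<in> U \<Longrightarrow> f k z = a k z + dbar (b k) z"
    using Suc.prems by auto
  show ?case
    by (rule weak_null_SucI[OF assms(1) null_on_bounded_linear[OF assms(1) scaleC.bounded_linear_right 1(1)] Suc.IH[OF 1(2)]])
      (simp add: 1(3) dbar_scaleC_const[OF weak_null_smooth[OF 1(2)]] scaleC_add_right)
qed

section \<open>Moments of weakly null sequences and regularity\<close>

lemma disc_moment_cong: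
  assumes "\<And>z. z \<in> cball z0 R \<Longrightarrow> f z = g z"
  shows "disc_moment R m i f z0 = disc_moment R m i g z0"
proof -
  have "f (z0 + complex_of_real r * cis t) = g (z0 + complex_of_real r * cis t)" if "r \<in> {0..R}" for r t
    using that by (intro assms) (auto simp: dist_norm norm_mult)
  then show ?thesis
    unfolding disc_moment_def circle_moment_def by (auto intro!: Henstock_Kurzweil_Integration.integral_cong)
qed

text \<open>The union is the Minkowski sum of \<open>K\<close> and \<open>cball 0 R\<close>.
  Estimates at centres in \<open>K\<close> use uniform convergence on this enlarged set.\<close>

lemma compact_UN_cball:
  fixes K :: "complex set"
  assumes K: "compact K"
  shows "compact (\<Union>z\<in>K. cball z R)"
proof -
  have "(\<Union>z\<in>K. cball z R) = {x + y |x y. x \<in> K \<and> y \<in> cball 0 R}"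
  proof (intro equalityI subsetI)
    fix w assume "w \<in> (\<Union>z\<in>K. cball z R)"
    then obtain z where "z \<in> K" "dist z w \<le> R" by auto
    then show "w \<in> {x + y |x y. x \<in> K \<and> y \<in> cball 0 R}"
      by (intro CollectI exI[of _ z] exI[of _ "w - z"]) (auto simp: dist_norm norm_minus_commute)
  next
    fix w assume "w \<in> {x + y |x y. x \<in> K \<and> y \<in> cball 0 R}"
    then obtain x y where "x \<in> K" "norm y \<le> R" "w = x + y" by auto
    then show "w \<in> (\<Union>z\<in>K. cball z R)"
      by (intro UN_I[of x]) (auto simp: dist_norm)
  qed
  then show ?thesis using compact_sums[OF K compact_cball[of 0 R]] by simp
qed

lemma uniform_limit_disc_moment_null_on:
  fixes f :: "nat \<Rightarrow> complex \<Rightarrow> 'a::chilbert_space"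
  assumes K: "compact K" and R: "0 < R" "(\<Union>z\<in>K. cball z R) \<subseteq> U" and f: "null_on U f"
  shows "uniform_limit K (\<lambda>k. disc_moment R m i (f k)) (\<lambda>_. 0) sequentially"
proof -
  let ?K = "\<Union>z\<in>K. cball z R"
  have cK: "compact ?K" by (rule compact_UN_cball[OF K])
  obtain C where C: "\<And>(f :: complex \<Rightarrow> 'a) U z0 B. cball z0 R \<subseteq> U \<Longrightarrow> continuous_on U f \<Longrightarrow>
    (\<And>z. z \<in> cball z0 R \<Longrightarrow> norm (f z) \<le> B) \<Longrightarrow> norm (disc_moment R m i f z0) \<le> C * B"
    using norm_disc_moment_le[OF R(1), of m i] by metis
  show ?thesis
  proof (rule uniform_limitI)
    fix e :: real assume e: "e > 0"
    define d where "d = e / (\<bar>C\<bar> + 1)"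
    have d: "d > 0" using e by (simp add: d_def add_nonneg_pos)
    from uniform_limitD[OF null_on_uniform_limit[OF f cK R(2)] d]
    have "\<forall>\<^sub>F k in sequentially. \<forall>z\<in>?K. dist (f k z) 0 < d" .
    then show "\<forall>\<^sub>F k in sequentially. \<forall>z\<in>K. dist (disc_moment R m i (f k) z) 0 < e"
    proof eventually_elim
      case (elim k)
      show ?case
      proof
        fix z assume z: "z \<in> K"
        have "norm (disc_moment R m i (f k) z) \<le> C * d"
        proof (rule C)
          show "cball z R \<subseteq> U" using R z by blast
          show "continuous_on U (f k)" by (rule smooth_on_imp_continuous_on[OF null_on_smooth[OF f]])
          show "norm (f k w) \<le> d" if "w \<in> cball z R" for w
            using elim z that by (force simp: dist_norm)
        qed
        also have "\<dots> \<le> \<bar>C\<bar> * d" using d by (simp add: mult_right_mono)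
        also have "\<dots> < (\<bar>C\<bar> + 1) * d" using d by simp
        also have "\<dots> = e" by (simp add: d_def field_simps)
        finally show "dist (disc_moment R m i (f k) z) 0 < e" by simp
      qed
    qed
  qed
qed

text \<open>The weight exponent equals the order \<open>m\<close>, so every dbar can be moved onto
  the weight. Each such move lowers \<open>m\<close> and raises \<open>i\<close>, hence the
  induction lets \<open>i\<close> vary.\<close>

lemma uniform_limit_disc_moment_weak_null:
  fixes f :: "nat \<Rightarrow> complex \<Rightarrow> 'a::chilbert_space"
  assumes U: "open U" and K: "compact K" and R: "0 < R" "(\<Union>z\<in>K. cball z R) \<subseteq> U" and f: "weak_null m U f"
  shows "uniform_limit K (\<lambda>k. disc_moment R m i (f k)) (\<lambda>_. 0) sequentially"
  using f
proof (induction m arbitrary: f i)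
  case 0
  then show ?case using uniform_limit_disc_moment_null_on[OF K R] by simp
next
  case (Suc m)
  obtain a b where ab: "null_on U a" "weak_null m U b" "\<And>k z. z \<in> U \<Longrightarrow> f k z = a k z + dbar (b k) z"
    using Suc.prems by auto
  have eq: "disc_moment R (Suc m) i (f k) z =
      disc_moment R (Suc m) i (a k) z + real (Suc m) *\<^sub>R disc_moment R m (Suc i) (b k) z" if z: "z \<in> K" for k z
  proof -
    have sub: "cball z R \<subseteq> U" using R z by blast
    have b: "smooth_on U (b k)" by (rule weak_null_smooth[OF ab(2)])
    have "disc_moment R (Suc m) i (f k) z = disc_moment R (Suc m) i (\<lambda>z. a k z + dbar (b k) z) z"
      using ab(3) sub by (intro disc_moment_cong) auto
    also have "\<dots> = disc_moment R (Suc m) i (a k) z + disc_moment R (Suc m) i (dbar (b k)) z"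
      by (intro disc_moment_add[OF sub] smooth_on_imp_continuous_on null_on_smooth[OF ab(1)] smooth_on_dbar U b)
    finally show ?thesis by (simp only: disc_moment_dbar[OF U sub R(1) b])
  qed
  have "uniform_limit K (\<lambda>k z. disc_moment R (Suc m) i (a k) z + real (Suc m) *\<^sub>R disc_moment R m (Suc i) (b k) z)
      (\<lambda>_. 0 + real (Suc m) *\<^sub>R 0) sequentially"
    by (intro uniform_limit_add uniform_limit_disc_moment_null_on[OF K R ab(1)]
        bounded_linear.uniform_limit[OF bounded_linear_scaleR_right] Suc.IH[OF ab(2)])
  then show ?case
    by (subst uniform_limit_cong'[OF eq refl]) simp_all
qed

text \<open>Elliptic regularity for sequences: with discs of one radius about all points of
  \<open>K\<close>, the estimate bounds \<open>f k\<close> by its disc moments and by dbar of it,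
  and both tend to 0 uniformly.\<close>

lemma null_on_if_weak_null_dbar_null:
  fixes f :: "nat \<Rightarrow> complex \<Rightarrow> 'a::chilbert_space"
  assumes U: "open U" and f: "weak_null m U f" and df: "null_on U (\<lambda>k. dbar (f k))"
  shows "null_on U f"
  unfolding null_on_def
proof (intro conjI allI impI)
  fix K assume K': "compact K \<and> K \<subseteq> U"
  then have K: "compact K" "K \<subseteq> U" by auto
  obtain R where R: "0 < R" "(\<Union>z\<in>K. cball z R) \<subseteq> U"
    using compact_subset_open_imp_cball_epsilon_subset[OF K(1) U K(2)] by metis
  obtain C where C: "C \<ge> 0" "\<And>(f :: complex \<Rightarrow> 'a) U z0 B. open U \<Longrightarrow> cball z0 R \<subseteq> U \<Longrightarrow>
    smooth_on U f \<Longrightarrow> (\<And>z. z \<in> cball z0 R \<Longrightarrow> norm (dbar f z) \<le> B) \<Longrightarrow>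
    norm (f z0) \<le> C * (norm (disc_moment R m 0 f z0) + B)"
    using norm_le_disc_moment_dbar[OF R(1), of m] by metis
  let ?K = "\<Union>z\<in>K. cball z R"
  have cK: "compact ?K" by (rule compact_UN_cball[OF K(1)])
  show "uniform_limit K f (\<lambda>_. 0) sequentially"
  proof (rule uniform_limitI)
    fix e :: real assume e: "e > 0"
    \<comment> \<open>Two contributions below \<open>d\<close> are added and multiplied by
      \<open>C\<close>; \<open>C + 1\<close> makes the last inequality strict even for
      \<open>C = 0\<close>.\<close>
    define d where "d = e / (C + 1) / 2"
    have d: "d > 0" using e C(1) by (simp add: d_def)
    from uniform_limitD[OF null_on_uniform_limit[OF df cK R(2)] d]
      uniform_limitD[OF uniform_limit_disc_moment_weak_null[OF U K(1) R f, of 0] d]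
    show "\<forall>\<^sub>F k in sequentially. \<forall>z\<in>K. dist (f k z) 0 < e"
    proof eventually_elim
      case (elim k)
      show ?case
      proof
        fix z assume z: "z \<in> K"
        have "norm (f k z) \<le> C * (norm (disc_moment R m 0 (f k) z) + d)"
        proof (rule C(2)[OF U])
          show "cball z R \<subseteq> U" using R z by blast
          show "smooth_on U (f k)" by (rule weak_null_smooth[OF f])
          show "norm (dbar (f k) w) \<le> d" if "w \<in> cball z R" for w
            using elim(1) z that by (force simp: dist_norm)
        qed
        also have "\<dots> \<le> C * (d + d)"
          using elim(2) z C(1) by (intro mult_left_mono) (auto simp: less_imp_le)
        also have "\<dots> < (C + 1) * (d + d)" using d by simp
        also have "d + d = e / (C + 1)" unfolding d_def by (rule field_sum_of_halves)
        also have "(C + 1) * (e / (C + 1)) = e" using C(1) by simp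
        finally show "dist (f k z) 0 < e" by simp
      qed
    qed
  qed
qed (rule weak_null_smooth[OF f])

text \<open>Descent on the order. If \<open>F (Suc j) = a + dbar b\<close> with \<open>a\<close>
  null, then \<open>F j - b\<close> is weakly null and its dbar is \<open>a\<close>, so it is null
  by regularity; thus \<open>F j\<close> inherits the lower order of \<open>b\<close>. All
  \<open>j\<close> descend together, since the step for \<open>j\<close> consults
  \<open>Suc j\<close>.\<close>

lemma null_on_if_all_weak_null:
  fixes F :: "nat \<Rightarrow> nat \<Rightarrow> complex \<Rightarrow> 'a::chilbert_space"
  assumes U: "open U" and dF: "\<And>j k z. z \<in> U \<Longrightarrow> dbar (F j k) z = F (Suc j) k z"
    and F: "\<And>j. weak_null m U (F j)"
  shows "null_on U (F j)"
  using F
proof (induction m arbitrary: j)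
  case 0
  then show ?case by simp
next
  case (Suc m)
  have "weak_null m U (F j)" for j
  proof -
    obtain a b where ab: "null_on U a" "weak_null m U b"
      "\<And>k z. z \<in> U \<Longrightarrow> F (Suc j) k z = a k z + dbar (b k) z"
      using Suc.prems[of "Suc j"] by auto
    note sF = weak_null_smooth[OF Suc.prems[of j]]
    have sb: "smooth_on U (\<lambda>z. (- 1) *\<^sub>C b k z)" for k
      by (rule smooth_on_scaleC_const[OF U weak_null_smooth[OF ab(2)]])
    let ?g = "\<lambda>k z. F j k z + (- 1) *\<^sub>C b k z"
    have g: "weak_null (Suc m) U ?g"
      by (intro weak_null_add U Suc.prems weak_null_scaleC weak_null_Suc ab)
    have dg: "dbar (?g k) z = a k z" if "z \<in> U" for k z
      using ab(3)[OF that] dbar_add[OF sF sb that] dF[OF that]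
        dbar_scaleC_const[OF weak_null_smooth[OF ab(2)] that, of "- 1"]
      by (simp add: scaleC.minus_left scaleC_one)
    have "null_on U (\<lambda>k. dbar (?g k))"
      by (rule null_on_cong[OF U ab(1)]) (simp add: dg)
    then have "null_on U ?g" by (rule null_on_if_weak_null_dbar_null[OF U g])
    \<comment> \<open>A null sequence is weakly null of every order, by climbing from order
      0.\<close>
    then have "weak_null m U ?g"
    proof (induction m)
      case (Suc m)
      then show ?case using weak_null_Suc[OF U] by blast
    qed simp
    from weak_null_add[OF U this ab(2)] show ?thesis
      by (simp add: scaleC.minus_left scaleC_one)
  qed
  then show ?case by (rule Suc.IH)
qed

section \<open>Normal operators\<close>

lemma smooth_on_dbar_funpow: "open U \<Longrightarrow> smooth_on U f \<Longrightarrow> smooth_on U ((dbar ^^ j) f)"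
  by (induction j) (auto intro: smooth_on_dbar)

text \<open>\<open>\<Phi>\<close> is kept abstract so that one induction serves bounded operators,
  multiplication by \<open>z\<close>, and \<open>T - z ^ n\<close>.\<close>

lemma dbar_funpow_commute:
  assumes U: "open U" and f: "smooth_on U f" and z: "z \<in> U"
    and \<Phi>: "\<And>f z. smooth_on U f \<Longrightarrow> z \<in> U \<Longrightarrow> dbar (\<Phi> f) z = \<Phi> (dbar f) z"
  shows "(dbar ^^ j) (\<Phi> f) z = \<Phi> ((dbar ^^ j) f) z"
  using z
proof (induction j arbitrary: z)
  case (Suc j)
  have "(dbar ^^ Suc j) (\<Phi> f) z = dbar (\<Phi> ((dbar ^^ j) f)) z"
    using dbar_cong[OF U Suc.prems Suc.IH] by simp
  then show ?case using \<Phi>[OF smooth_on_dbar_funpow[OF U f] Suc.prems] by simp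
qed simp

lemma dbar_funpow_cong:
  assumes "open U" "z \<in> U" "\<And>w. w \<in> U \<Longrightarrow> f w = g w"
  shows "(dbar ^^ j) f z = (dbar ^^ j) g z"
  using assms(2)
proof (induction j arbitrary: z)
  case (Suc j)
  show ?case using dbar_cong[OF assms(1) Suc.prems Suc.IH] by simp
qed (simp add: assms(3))

lemma smooth_on_diff_scaleC_power:
  fixes f :: "complex \<Rightarrow> 'a::complex_inner"
  assumes U: "open U" and T: "bounded_clinear T" and \<phi>: "bounded_linear \<phi>" and f: "smooth_on U f"
  shows "smooth_on U (\<lambda>z. T (f z) - \<phi> z ^ n *\<^sub>C f z)"
proof -
  have "smooth_on U (\<lambda>z. T (f z) + (- 1) *\<^sub>C (\<phi> z ^ n *\<^sub>C f z))"
    by (intro smooth_on_add U smooth_on_bounded_linear[OF U bounded_clinear_bounded_linear[OF T] f]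
        smooth_on_scaleC_const smooth_on_scaleC_power \<phi> f)
  then show ?thesis by (simp add: scaleC.minus_left scaleC_one)
qed

lemma dbar_diff_scaleC_power:
  fixes f :: "complex \<Rightarrow> 'a::complex_inner"
  assumes U: "open U" and T: "bounded_clinear T" and \<phi>: "bounded_linear \<phi>" and f: "smooth_on U f" and z: "z \<in> U"
  shows "dbar (\<lambda>z. T (f z) - \<phi> z ^ n *\<^sub>C f z) z = T (dbar f z) - dbar (\<lambda>z. \<phi> z ^ n *\<^sub>C f z) z"
proof -
  have "dbar (\<lambda>z. T (f z) + (- 1) *\<^sub>C (\<phi> z ^ n *\<^sub>C f z)) z = T (dbar f z) + (- 1) *\<^sub>C dbar (\<lambda>z. \<phi> z ^ n *\<^sub>C f z) z"
    by (simp only: dbar_add[OF smooth_on_bounded_linear[OF U bounded_clinear_bounded_linear[OF T] f]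
        smooth_on_scaleC_const[OF U smooth_on_scaleC_power[OF U \<phi> f]] z]
        dbar_bounded_clinear[OF T f z] dbar_scaleC_const[OF smooth_on_scaleC_power[OF U \<phi> f] z])
  then show ?thesis by (simp add: scaleC.minus_left scaleC_one)
qed

text \<open>dbar commutes with \<open>T - z ^ n\<close> but not with \<open>T' - cnj z ^ n\<close>.
  Normality transfers smallness from the first to the second, and the commutator
  \<open>n * cnj z ^ (n - 1)\<close> then isolates the functions themselves. Each step from
  \<open>F j\<close> involves \<open>F (Suc j)\<close>, so all powers of dbar are treated at
  once.\<close>

lemma null_on_dbar_funpow_if_normal:
  fixes T T' :: "'a::chilbert_space \<Rightarrow> 'a"
  assumes T: "bounded_clinear T" and T': "bounded_clinear T'"
    and norm_eq: "\<And>c x. norm (T x - c *\<^sub>C x) = norm (T' x - cnj c *\<^sub>C x)"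
    and n: "n > 0" and U: "open U" and f: "\<And>k. smooth_on U (f k)"
    and h: "\<And>j. null_on U (\<lambda>k. (dbar ^^ j) (\<lambda>z. T (f k z) - z ^ n *\<^sub>C f k z))"
  shows "null_on U (\<lambda>k. (dbar ^^ j) (f k))"
proof -
  define F where "F = (\<lambda>j k. (dbar ^^ j) (f k))"
  define u where "u = (\<lambda>j k z. T' (F j k z) - cnj z ^ n *\<^sub>C F j k z)"
  have sF: "smooth_on U (F j k)" for j k
    unfolding F_def by (rule smooth_on_dbar_funpow[OF U f])
  have dF: "dbar (F j k) = F (Suc j) k" for j k by (simp add: F_def)
  have su: "smooth_on U (u j k)" for j k
    unfolding u_def by (rule smooth_on_diff_scaleC_power[OF U T' bounded_linear_cnj sF])
  have h_eq: "(dbar ^^ j) (\<lambda>z. T (f k z) - z ^ n *\<^sub>C f k z) z = T (F j k z) - z ^ n *\<^sub>C F j k z" if "z \<in> U" for j k z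
    unfolding F_def
  proof (rule dbar_funpow_commute[OF U f that, where \<Phi>="\<lambda>f z. T (f z) - z ^ n *\<^sub>C f z"])
    show "dbar (\<lambda>z. T (f z) - z ^ n *\<^sub>C f z) z = T (dbar f z) - z ^ n *\<^sub>C dbar f z"
      if "smooth_on U f" "z \<in> U" for f z
      using dbar_diff_scaleC_power[OF U T bounded_linear_ident that] dbar_power[OF that] by simp
  qed
  \<comment> \<open>Pointwise, \<open>u j\<close> has the same norm as the \<open>j\<close>-th dbar
    power of the given null sequence.\<close>
  have u: "null_on U (u j)" for j
  proof (rule null_on_dominated[OF h[of j] su])
    fix K assume "K \<subseteq> U"
    then have "norm (u j k z) = norm ((dbar ^^ j) (\<lambda>z. T (f k z) - z ^ n *\<^sub>C f k z) z)" if "z \<in> K" for k z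
      using h_eq that norm_eq[of _ "z ^ n"] by (auto simp: u_def subset_iff)
    then show "\<exists>C. \<forall>z\<in>K. \<forall>k. norm (u j k z) \<le> C * norm ((dbar ^^ j) (\<lambda>z. T (f k z) - z ^ n *\<^sub>C f k z) z)"
      by (intro exI[of _ 1]) simp
  qed
  have du: "dbar (u j k) z = u (Suc j) k z - (of_nat n * cnj z ^ (n - 1)) *\<^sub>C F j k z" if "z \<in> U" for j k z
    unfolding u_def using dbar_diff_scaleC_power[OF U T' bounded_linear_cnj sF that, where n=n]
      dbar_cnj_power[OF sF that] by (simp add: dF)
  \<comment> \<open>\<open>i\<close> counts the factors \<open>cnj z\<close> already removed; each
    removal costs one order, so none is left at order \<open>n\<close>.\<close>
  have "weak_null (Suc i) U (\<lambda>k z. cnj z ^ (n - 1 - i) *\<^sub>C F j k z)" if "i < n" for i j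
    using that
  proof (induction i arbitrary: j)
    case 0
    \<comment> \<open>\<open>?a\<close> and \<open>?b\<close> come from solving \<open>du\<close>
      for the term with \<open>F j\<close> and dividing by \<open>n\<close>.\<close>
    let ?a = "\<lambda>k z. (1 / of_nat n) *\<^sub>C u (Suc j) k z"
    let ?b = "\<lambda>k z. (- 1 / of_nat n) *\<^sub>C u j k z"
    show ?case
    proof (rule weak_null_SucI[OF U])
      show "null_on U ?a"
        by (rule null_on_bounded_linear[OF U scaleC.bounded_linear_right u])
      show "weak_null 0 U ?b"
        using null_on_bounded_linear[OF U scaleC.bounded_linear_right u] by simp
      show "cnj z ^ (n - 1 - 0) *\<^sub>C F j k z = ?a k z + dbar (?b k) z" if "z \<in> U" for k z
        using n dbar_scaleC_const[OF su that, of "- 1 / of_nat n"]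
        by (simp add: du[OF that] scaleC.diff_right scaleC_scaleC scaleC.minus_left)
    qed
  next
    case (Suc i)
    define m where "m = n - 1 - i"
    have m: "m > 0" "n - 1 - Suc i = m - 1" using Suc.prems by (auto simp: m_def)
    let ?g = "\<lambda>j k z. cnj z ^ m *\<^sub>C F j k z"
    have g: "weak_null (Suc i) U (?g j)" for j
      using Suc.IH Suc.prems unfolding m_def by simp
    have dg: "dbar (?g j k) z = ?g (Suc j) k z + (of_nat m * cnj z ^ (m - 1)) *\<^sub>C F j k z" if "z \<in> U" for k z
      using dbar_cnj_power[OF sF that] by (simp add: dF)
    \<comment> \<open>The product rule \<open>dg\<close>, solved for \<open>cnj z ^ (m - 1)\<close>
      times \<open>F j\<close>; division by \<open>m\<close> is legitimate as
      \<open>m > 0\<close>.\<close>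
    have "weak_null (Suc (Suc i)) U (\<lambda>k z. (1 / of_nat m) *\<^sub>C (dbar (?g j k) z + (- 1) *\<^sub>C ?g (Suc j) k z))"
      by (intro weak_null_scaleC weak_null_add U weak_null_dbar[of U "Suc i" "?g j"] weak_null_Suc g)
    then show ?case
      by (rule weak_null_cong[OF U])
        (use m in \<open>simp add: dg scaleC_add_right scaleC_scaleC scaleC.minus_left\<close>)
  qed
  from this[of "n - 1"] have "weak_null n U (F j)" for j
    using n by (simp add: scaleC_one)
  then have "null_on U (F j)" for j
    by (intro null_on_if_all_weak_null[OF U]) (simp_all add: dF)
  then show ?thesis by (simp add: F_def)
qed

section \<open>Control of all partial derivatives\<close>

text \<open>Partial derivatives are taken before the powers of dbar, so that no interchange of mixed partial
  derivatives is ever needed.\<close>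
fun deriv_null :: "nat \<Rightarrow> complex set \<Rightarrow> (nat \<Rightarrow> complex \<Rightarrow> 'a::complex_inner) \<Rightarrow> bool" where
  "deriv_null 0 U f = (\<forall>j. null_on U (\<lambda>k. (dbar ^^ j) (f k)))"
| "deriv_null (Suc l) U f = (deriv_null l U f \<and> (\<forall>d. deriv_null l U (\<lambda>k. pderiv_dir d (f k))))"

lemma deriv_null_null_on: "deriv_null l U f \<Longrightarrow> null_on U f"
proof (induction l)
  case 0
  then have "null_on U (\<lambda>k. (dbar ^^ 0) (f k))" unfolding deriv_null.simps by (rule spec)
  then show ?case by simp
qed simp

lemma deriv_null_smooth: "deriv_null l U f \<Longrightarrow> smooth_on U (f k)"
  by (rule null_on_smooth[OF deriv_null_null_on])

lemma deriv_null_cong: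
  assumes U: "open U" and "deriv_null l U f" and "\<And>k z. z \<in> U \<Longrightarrow> f k z = g k z"
  shows "deriv_null l U g"
  using assms(2,3)
proof (induction l arbitrary: f g)
  case 0
  show ?case unfolding deriv_null.simps
  proof
    fix j
    have "null_on U (\<lambda>k. (dbar ^^ j) (f k))" using 0(1) by simp
    then show "null_on U (\<lambda>k. (dbar ^^ j) (g k))"
      by (rule null_on_cong[OF U]) (rule dbar_funpow_cong[OF U _ 0(2)])
  qed
next
  case (Suc l)
  have "deriv_null l U (\<lambda>k. pderiv_dir d (g k))" for d
    by (rule Suc.IH[of "\<lambda>k. pderiv_dir d (f k)"])
      (use Suc.prems(1) pderiv_dir_cong[OF U _ Suc.prems(2)] in auto)
  moreover have "deriv_null l U g"
    using Suc.IH[of f g] Suc.prems by simp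
  ultimately show ?case by simp
qed

lemma dbar_funpow_add:
  assumes U: "open U" and f: "smooth_on U f" and g: "smooth_on U g" and z: "z \<in> U"
  shows "(dbar ^^ j) (\<lambda>z. f z + g z) z = (dbar ^^ j) f z + (dbar ^^ j) g z"
  using z
proof (induction j arbitrary: z)
  case (Suc j)
  then show ?case
    using dbar_cong[OF U Suc.prems Suc.IH] dbar_add[OF smooth_on_dbar_funpow[OF U f] smooth_on_dbar_funpow[OF U g] Suc.prems]
    by simp
qed simp

lemma deriv_null_add:
  assumes U: "open U" and "deriv_null l U f" "deriv_null l U g"
  shows "deriv_null l U (\<lambda>k z. f k z + g k z)"
  using assms(2,3)
proof (induction l arbitrary: f g)
  case 0
  show ?case unfolding deriv_null.simps
  proof
    fix j
    have "null_on U (\<lambda>k z. (dbar ^^ j) (f k) z + (dbar ^^ j) (g k) z)"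
      using 0 by (intro null_on_add U) auto
    then show "null_on U (\<lambda>k. (dbar ^^ j) (\<lambda>z. f k z + g k z))"
      by (rule null_on_cong[OF U])
        (simp add: dbar_funpow_add[OF U deriv_null_smooth[OF 0(1)] deriv_null_smooth[OF 0(2)]])
  qed
next
  case (Suc l)
  have "deriv_null l U (\<lambda>k. pderiv_dir d (\<lambda>z. f k z + g k z))" for d
  proof (rule deriv_null_cong[OF U])
    show "deriv_null l U (\<lambda>k z. pderiv_dir d (f k) z + pderiv_dir d (g k) z)"
      using Suc.prems by (intro Suc.IH) auto
    show "pderiv_dir d (f k) z + pderiv_dir d (g k) z = pderiv_dir d (\<lambda>z. f k z + g k z) z" if "z \<in> U" for k z
      using has_pd_imp_pderiv_dir[OF has_pd_add[OF smooth_on_has_pd[OF deriv_null_smooth[OF Suc.prems(1)] that]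
          smooth_on_has_pd[OF deriv_null_smooth[OF Suc.prems(2)] that]]] by simp
  qed
  then show ?case using Suc.IH[of f g] Suc.prems by simp
qed

lemma deriv_null_bounded_clinear:
  assumes U: "open U" and L: "bounded_clinear L" and "deriv_null l U f"
  shows "deriv_null l U (\<lambda>k z. L (f k z))"
  using assms(3)
proof (induction l arbitrary: f)
  case 0
  have eq: "(dbar ^^ j) (\<lambda>z. L (f k z)) z = L ((dbar ^^ j) (f k) z)" if "z \<in> U" for j k z
    using deriv_null_smooth[OF 0] that
    by (intro dbar_funpow_commute[OF U, where \<Phi>="\<lambda>f z. L (f z)"] dbar_bounded_clinear[OF L]) auto
  have "null_on U (\<lambda>k. (dbar ^^ j) (\<lambda>z. L (f k z)))" for j
  proof -
    have "null_on U (\<lambda>k. (dbar ^^ j) (f k))" using 0 by simp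
    from null_on_bounded_linear[OF U bounded_clinear_bounded_linear[OF L] this] show ?thesis
      by (rule null_on_cong[OF U]) (simp add: eq)
  qed
  then show ?case by simp
next
  case (Suc l)
  have "deriv_null l U (\<lambda>k. pderiv_dir d (\<lambda>z. L (f k z)))" for d
  proof (rule deriv_null_cong[OF U])
    show "deriv_null l U (\<lambda>k z. L (pderiv_dir d (f k) z))"
      using Suc.prems by (intro Suc.IH) auto
    show "L (pderiv_dir d (f k) z) = pderiv_dir d (\<lambda>z. L (f k z)) z" if "z \<in> U" for k z
      using has_pd_imp_pderiv_dir[OF has_pd_bounded_linear[OF bounded_clinear_bounded_linear[OF L]
          smooth_on_has_pd[OF deriv_null_smooth[OF Suc.prems] that]]] by simp
  qed
  then show ?case using Suc.IH[of f] Suc.prems by simp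
qed

lemma pderiv_dir_power:
  fixes f :: "complex \<Rightarrow> 'a::complex_inner"
  assumes "smooth_on U f" "z \<in> U"
  shows "pderiv_dir d (\<lambda>z. z ^ n *\<^sub>C f z) z =
    z ^ n *\<^sub>C pderiv_dir d f z + (of_nat n * z ^ (n - 1) * (if d then \<i> else 1)) *\<^sub>C f z"
  by (rule has_pd_imp_pderiv_dir[OF has_pd_scaleC_power[OF bounded_linear_ident smooth_on_has_pd[OF assms]]])

lemma deriv_null_scaleC_ident:
  assumes U: "open U" and "deriv_null l U f"
  shows "deriv_null l U (\<lambda>k z. z *\<^sub>C f k z)"
  using assms(2)
proof (induction l arbitrary: f)
  case 0
  have eq: "(dbar ^^ j) (\<lambda>z. z *\<^sub>C f k z) z = z *\<^sub>C (dbar ^^ j) (f k) z" if "z \<in> U" for j k z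
    using deriv_null_smooth[OF 0] that dbar_power[of U _ _ 1]
    by (intro dbar_funpow_commute[OF U, where \<Phi>="\<lambda>f z. z *\<^sub>C f z"]) auto
  have "null_on U (\<lambda>k. (dbar ^^ j) (\<lambda>z. z *\<^sub>C f k z))" for j
  proof -
    have "null_on U (\<lambda>k. (dbar ^^ j) (f k))" using 0 by simp
    from null_on_scaleC_linear[OF U bounded_linear_ident this] show ?thesis
      by (rule null_on_cong[OF U]) (simp add: eq)
  qed
  then show ?case by simp
next
  case (Suc l)
  have "deriv_null l U (\<lambda>k. pderiv_dir d (\<lambda>z. z *\<^sub>C f k z))" for d
  proof (rule deriv_null_cong[OF U])
    show "deriv_null l U (\<lambda>k z. z *\<^sub>C pderiv_dir d (f k) z + (if d then \<i> else 1) *\<^sub>C f k z)"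
      using Suc.prems by (intro deriv_null_add U Suc.IH deriv_null_bounded_clinear[OF U bounded_clinear_scaleC_const]) auto
    show "z *\<^sub>C pderiv_dir d (f k) z + (if d then \<i> else 1) *\<^sub>C f k z = pderiv_dir d (\<lambda>z. z *\<^sub>C f k z) z" if "z \<in> U" for k z
      using pderiv_dir_power[OF deriv_null_smooth[OF Suc.prems] that, of d 1] by simp
  qed
  then show ?case using Suc.IH[of f] Suc.prems by simp
qed

lemma deriv_null_scaleC_power:
  assumes U: "open U" and "deriv_null l U f"
  shows "deriv_null l U (\<lambda>k z. z ^ n *\<^sub>C f k z)"
proof (induction n)
  case (Suc n)
  from deriv_null_scaleC_ident[OF U this] show ?case by (simp add: scaleC_scaleC)
qed (simp add: scaleC_one assms)

text \<open>A partial derivative of \<open>f\<close> solves the same problem up to a commutator: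
  \<open>(T - z ^ n)\<close> applied to it is the partial derivative of \<open>(T - z ^ n) f\<close>
  plus \<open>n * z ^ (n - 1)\<close> times \<open>f\<close>, with a further factor 1 or
  \<open>\<i>\<close>.\<close>

lemma deriv_null_if_normal:
  fixes T T' :: "'a::chilbert_space \<Rightarrow> 'a"
  assumes T: "bounded_clinear T" and T': "bounded_clinear T'"
    and norm_eq: "\<And>c x. norm (T x - c *\<^sub>C x) = norm (T' x - cnj c *\<^sub>C x)"
    and n: "n > 0" and U: "open U"
    and "\<And>k. smooth_on U (f k)" "deriv_null l U (\<lambda>k z. T (f k z) - z ^ n *\<^sub>C f k z)"
  shows "deriv_null l U f"
  using assms(6,7)
proof (induction l arbitrary: f)
  case 0
  then show ?case
    using null_on_dbar_funpow_if_normal[OF T T' norm_eq n U, of f] by simp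
next
  case (Suc l)
  \<comment> \<open>Level \<open>l\<close> for \<open>f\<close> itself comes first; it makes the
    commutator term admissible when the induction hypothesis is applied to the partial
    derivatives.\<close>
  have f: "deriv_null l U f" using Suc by simp
  have "deriv_null l U (\<lambda>k. pderiv_dir d (f k))" for d
  proof (rule Suc.IH)
    show "smooth_on U (pderiv_dir d (f k))" for k by (rule smooth_on_pderiv_dir[OF Suc.prems(1)])
    show "deriv_null l U (\<lambda>k z. T (pderiv_dir d (f k) z) - z ^ n *\<^sub>C pderiv_dir d (f k) z)"
    proof (rule deriv_null_cong[OF U])
      show "deriv_null l U (\<lambda>k z. pderiv_dir d (\<lambda>z. T (f k z) - z ^ n *\<^sub>C f k z) z +
          (of_nat n * (if d then \<i> else 1)) *\<^sub>C z ^ (n - 1) *\<^sub>C f k z)"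
        using Suc.prems(2)
        by (intro deriv_null_add U deriv_null_bounded_clinear[OF U bounded_clinear_scaleC_const]
            deriv_null_scaleC_power f) auto
      fix k z assume z: "z \<in> U"
      have p: "has_pd d (\<lambda>z. z ^ n *\<^sub>C f k z) (pderiv_dir d (\<lambda>z. z ^ n *\<^sub>C f k z) z) z"
        by (rule smooth_on_has_pd[OF smooth_on_scaleC_power[OF U bounded_linear_ident Suc.prems(1)] z])
      have "has_pd d (\<lambda>z. T (f k z) + (- 1) *\<^sub>C (z ^ n *\<^sub>C f k z))
        (T (pderiv_dir d (f k) z) + (- 1) *\<^sub>C pderiv_dir d (\<lambda>z. z ^ n *\<^sub>C f k z) z) z"
        by (intro has_pd_add has_pd_bounded_linear[OF bounded_clinear_bounded_linear[OF T]]
            smooth_on_has_pd[OF Suc.prems(1) z] has_pd_bounded_linear[OF scaleC.bounded_linear_right p])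
      then have "pderiv_dir d (\<lambda>z. T (f k z) - z ^ n *\<^sub>C f k z) z =
        T (pderiv_dir d (f k) z) - pderiv_dir d (\<lambda>z. z ^ n *\<^sub>C f k z) z"
        by (intro has_pd_imp_pderiv_dir) (simp add: scaleC.minus_left scaleC_one)
      then show "pderiv_dir d (\<lambda>z. T (f k z) - z ^ n *\<^sub>C f k z) z +
          (of_nat n * (if d then \<i> else 1)) *\<^sub>C z ^ (n - 1) *\<^sub>C f k z =
          T (pderiv_dir d (f k) z) - z ^ n *\<^sub>C pderiv_dir d (f k) z"
        by (simp add: pderiv_dir_power[OF Suc.prems(1) z] scaleC_scaleC mult_ac)
    qed
  qed
  then show ?case using f by simp
qed

section \<open>Property beta\<close>

lemma Dmulti_add:
  assumes U: "open U" and "smooth_on U f" "smooth_on U g" "z \<in> U"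
  shows "Dmulti ds (\<lambda>z. f z + g z) z = Dmulti ds f z + Dmulti ds g z"
  using assms(2-)
proof (induction ds arbitrary: f g)
  case (Cons d ds)
  have "Dmulti ds (pderiv_dir d (\<lambda>z. f z + g z)) z = Dmulti ds (\<lambda>z. pderiv_dir d f z + pderiv_dir d g z) z"
    using smooth_on_has_pd[OF Cons.prems(1)] smooth_on_has_pd[OF Cons.prems(2)]
    by (intro Dmulti_cong[OF U Cons.prems(3)] has_pd_imp_pderiv_dir has_pd_add) auto
  then show ?case
    using Cons.IH[OF smooth_on_pderiv_dir[OF Cons.prems(1)] smooth_on_pderiv_dir[OF Cons.prems(2)] Cons.prems(3)]
    by simp
qed simp

lemma Dmulti_bounded_linear:
  assumes U: "open U" and L: "bounded_linear L" and "smooth_on U f" "z \<in> U"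
  shows "Dmulti ds (\<lambda>z. L (f z)) z = L (Dmulti ds f z)"
  using assms(3-)
proof (induction ds arbitrary: f)
  case (Cons d ds)
  have "Dmulti ds (pderiv_dir d (\<lambda>z. L (f z))) z = Dmulti ds (\<lambda>z. L (pderiv_dir d f z)) z"
    using smooth_on_has_pd[OF Cons.prems(1)]
    by (intro Dmulti_cong[OF U Cons.prems(2)] has_pd_imp_pderiv_dir has_pd_bounded_linear[OF L]) auto
  then show ?case using Cons.IH[OF smooth_on_pderiv_dir[OF Cons.prems(1)] Cons.prems(2)] by simp
qed simp

lemma E_tendsto_zero_pderiv_dir:
  "E_tendsto_zero U f \<Longrightarrow> E_tendsto_zero U (\<lambda>k. pderiv_dir d (f k))"
  unfolding E_tendsto_zero_def by (simp flip: Dmulti.simps(2))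

text \<open>\<open>Dmulti\<close> takes the head of the list as innermost derivative, so the partial
  derivatives inside dbar just become a new head.\<close>

lemma E_tendsto_zero_dbar:
  assumes U: "open U" and f: "\<And>k. smooth_on U (f k)" and E: "E_tendsto_zero U f"
  shows "E_tendsto_zero U (\<lambda>k. dbar (f k))"
  unfolding E_tendsto_zero_def
proof (intro allI impI)
  fix K ds assume K: "compact K \<and> K \<subseteq> U"
  note s = smooth_on_pderiv_dir[OF f]
  have eq: "Dmulti ds (dbar (f k)) z =
      (1/2) *\<^sub>C (Dmulti (False # ds) (f k) z + \<i> *\<^sub>C Dmulti (True # ds) (f k) z)" if "z \<in> K" for k z
  proof -
    have z: "z \<in> U" using that K by blast
    show ?thesis
      unfolding dbar_def[abs_def]
      by (simp add: Dmulti_bounded_linear[OF U scaleC.bounded_linear_right _ z] s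
          smooth_on_add[OF U] smooth_on_scaleC_const[OF U] Dmulti_add[OF U _ _ z])
  qed
  have lim: "uniform_limit K (\<lambda>k z. Dmulti (d # ds) (f k) z) (\<lambda>_. 0) sequentially" for d
    using E K unfolding E_tendsto_zero_def by blast
  have "uniform_limit K (\<lambda>k z. (1/2) *\<^sub>C (Dmulti (False # ds) (f k) z + \<i> *\<^sub>C Dmulti (True # ds) (f k) z))
      (\<lambda>z. (1/2) *\<^sub>C (0 + \<i> *\<^sub>C 0)) sequentially"
    by (intro bounded_linear.uniform_limit[OF scaleC.bounded_linear_right] uniform_limit_add lim)
  then show "uniform_limit K (\<lambda>k. Dmulti ds (dbar (f k))) (\<lambda>_. 0) sequentially"
    by (subst uniform_limit_cong'[OF eq refl]) (simp_all add: scaleC.zero_right)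
qed

lemma E_tendsto_zero_imp_null_on:
  assumes "\<And>k. smooth_on U (f k)" "E_tendsto_zero U f"
  shows "null_on U f"
  unfolding null_on_def
proof (intro conjI allI impI assms(1))
  fix K assume "compact K \<and> K \<subseteq> U"
  then have "uniform_limit K (\<lambda>k. Dmulti [] (f k)) (\<lambda>_. 0) sequentially"
    using assms(2) unfolding E_tendsto_zero_def by blast
  then show "uniform_limit K f (\<lambda>_. 0) sequentially" by simp
qed

lemma E_tendsto_zero_imp_deriv_null:
  assumes U: "open U" and "\<And>k. smooth_on U (f k)" "E_tendsto_zero U f"
  shows "deriv_null l U f"
  using assms(2,3)
proof (induction l arbitrary: f)
  case 0
  have "E_tendsto_zero U (\<lambda>k. (dbar ^^ j) (f k))" for j
  proof (induction j)
    case (Suc j)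
    from E_tendsto_zero_dbar[OF U smooth_on_dbar_funpow[OF U 0(1)] this] show ?case by simp
  qed (simp add: 0)
  then show ?case
    using smooth_on_dbar_funpow[OF U 0(1)] by (auto intro: E_tendsto_zero_imp_null_on)
next
  case (Suc l)
  have "deriv_null l U (\<lambda>k. pderiv_dir d (f k))" for d
    by (rule Suc.IH[OF smooth_on_pderiv_dir[OF Suc.prems(1)] E_tendsto_zero_pderiv_dir[OF Suc.prems(2)]])
  then show ?case using Suc.IH[OF Suc.prems] by simp
qed

text \<open>Each direction in \<open>ds\<close> uses up one level, so level \<open>length ds\<close>
  controls \<open>Dmulti ds\<close>.\<close>

lemma deriv_null_imp_E_tendsto_zero:
  assumes "\<And>l. deriv_null l U f"
  shows "E_tendsto_zero U f"
proof -
  have "null_on U (\<lambda>k. Dmulti ds (f k))" if "deriv_null (length ds) U f" for ds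
    using that
  proof (induction ds arbitrary: f)
    case Nil
    then show ?case using deriv_null_null_on[of 0 U f] by simp
  qed simp
  then show ?thesis
    unfolding E_tendsto_zero_def using assms null_on_uniform_limit by blast
qed

text \<open>Telescoping: the difference for \<open>Suc m\<close> is \<open>A\<close> applied to the
  one for \<open>m\<close>, plus \<open>z ^ m\<close> times \<open>A f - z f\<close>.\<close>

lemma deriv_null_power_diff:
  fixes A :: "'a::complex_inner \<Rightarrow> 'a"
  assumes U: "open U" and A: "bounded_clinear A" and h: "deriv_null l U (\<lambda>k z. A (f k z) - z *\<^sub>C f k z)"
  shows "deriv_null l U (\<lambda>k z. (A ^^ m) (f k z) - z ^ m *\<^sub>C f k z)"
proof (induction m)
  case 0
  show ?case
    using deriv_null_bounded_clinear[OF U bounded_clinear_scaleC_const[of 0] h]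
    by (simp add: scaleC_one scaleC.zero_left)
next
  case (Suc m)
  have lin: "A (x - y) = A x - A y" for x y
    by (rule linear_diff[OF bounded_linear.linear[OF bounded_clinear_bounded_linear[OF A]]])
  from deriv_null_add[OF U deriv_null_bounded_clinear[OF U A Suc] deriv_null_scaleC_power[OF U h, of m]]
  show ?case
    by (simp add: lin bounded_clinear_scaleC[OF A] scaleC.diff_right scaleC_scaleC mult.commute)
qed

lemma beta_eps_if_power_normal:
  fixes A B :: "'a::chilbert_space \<Rightarrow> 'a"
  assumes n: "n > 0" and A: "bounded_clinear A" and adj: "is_adjoint A B"
    and comm: "\<And>x. B ((A ^^ n) x) = (A ^^ n) (B x)"
  shows "beta_eps A"
  unfolding beta_eps_def beta_eps_at_def
\<comment> \<open>The whole plane serves as the neighbourhood of every point.\<close>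
proof (intro allI exI[of _ UNIV] conjI impI)
  fix U :: "complex set" and f
  assume *: "open U \<and> U \<subseteq> UNIV \<and> (\<forall>k. smooth_on U (f k)) \<and>
    E_tendsto_zero U (\<lambda>k z. A (f k z) - z *\<^sub>C f k z)"
  then have U: "open U" and f: "\<And>k. smooth_on U (f k)"
    and E: "E_tendsto_zero U (\<lambda>k z. A (f k z) - z *\<^sub>C f k z)" by auto
  have B: "bounded_clinear B" by (rule bounded_clinear_adjoint[OF A adj])
  \<comment> \<open>Iterating the commutation up to \<open>m = n\<close> shows that
    \<open>A ^^ n\<close> commutes with its adjoint \<open>B ^^ n\<close>, that is, that it is
    normal.\<close>
  have "(B ^^ m) ((A ^^ n) x) = (A ^^ n) ((B ^^ m) x)" for m x
    by (induction m) (simp_all add: comm)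
  then have norm_eq: "norm ((A ^^ n) x - c *\<^sub>C x) = norm ((B ^^ n) x - cnj c *\<^sub>C x)" for c x
    by (rule norm_diff_scaleC_normal[OF bounded_clinear_funpow[OF A] is_adjoint_funpow[OF adj]])
  have "smooth_on U (\<lambda>z. A (f k z) - z *\<^sub>C f k z)" for k
    using smooth_on_diff_scaleC_power[OF U A bounded_linear_ident f, where n=1] by simp
  then have "deriv_null l U (\<lambda>k z. (A ^^ n) (f k z) - z ^ n *\<^sub>C f k z)" for l
    by (rule deriv_null_power_diff[OF U A E_tendsto_zero_imp_deriv_null[OF U _ E]])
  then have "deriv_null l U f" for l
    by (rule deriv_null_if_normal[OF bounded_clinear_funpow[OF A] bounded_clinear_funpow[OF B] norm_eq n U f])
  then show "E_tendsto_zero U f" by (rule deriv_null_imp_E_tendsto_zero)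
qed auto

theorem theorem3p6:
  fixes A Aadj :: "'a::chilbert_space \<Rightarrow> 'a" and n :: nat
  assumes "infinite_dimensional TYPE('a)"
    and "n > 1"
    and "bounded_clinear A"
    and "is_adjoint A Aadj"
    and "\<forall>x. Aadj ((A ^^ n) x) = (A ^^ n) (Aadj x)"
  shows "beta_eps A \<and> beta_eps Aadj"
proof
  have n: "n > 0" using assms(2) by simp
  show "beta_eps A"
    using assms(5) by (intro beta_eps_if_power_normal[OF n assms(3,4)]) simp
  have adj_n: "is_adjoint (A ^^ n) (Aadj ^^ n)" by (rule is_adjoint_funpow[OF assms(4)])
  \<comment> \<open>The hypothesis with adjoints taken on both sides; it allows the previous lemma
    to be used with \<open>A\<close> and \<open>Aadj\<close> exchanged.\<close>
  have "A ((Aadj ^^ n) x) = (Aadj ^^ n) (A x)" for x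
  proof (rule cinner_eqI)
    fix y
    have "cinner y (A ((Aadj ^^ n) x)) = cinner ((A ^^ n) (Aadj y)) x"
      using is_adjoint_commute[OF assms(4)] adj_n unfolding is_adjoint_def by simp
    also have "\<dots> = cinner (Aadj ((A ^^ n) y)) x" using assms(5) by simp
    also have "\<dots> = cinner y ((Aadj ^^ n) (A x))"
      using is_adjoint_commute[OF assms(4)] adj_n unfolding is_adjoint_def by simp
    finally show "cinner y (A ((Aadj ^^ n) x)) = cinner y ((Aadj ^^ n) (A x))" .
  qed
  then show "beta_eps Aadj"
    by (rule beta_eps_if_power_normal[OF n bounded_clinear_adjoint[OF assms(3,4)]
          is_adjoint_commute[OF assms(4)]])
qed

end
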